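(* Let $G$ be a $\mathbb{Z}$-invariant valued abelian group. Assume that for all $g\in G$ and $m\in\mathbb{N}$ the set $\Delta_m(g)=\{\mathrm{val}(g-mg')\mid g'\in G\}$ admits a maximum. Let $H/G$ be an extension of valued abelian groups, where $H$ is not necessarily $\mathbb{Z}$-invariant. Then $H/G$ is maximal if and only if $H/G$ is pseudo-complete. In particular, a $\mathbb{Z}$-invariant valued abelian group $G$ is maximal if and only if it is pseudo-complete.
   Context: $\mathbb N$ contains $0$. A valued abelian group is an abelian group $G$ with a surjection $\mathrm{val}:G\to\Gamma_G$ onto a linearly ordered set with maximum $\infty$ such that $\mathrm{val}(g)=\infty$ iff $g=0$, and $\mathrm{val}(g-h)\ge\min\{\mathrm{val}(g),\mathrm{val}(h)\}$. It is $\mathbb{Z}$-invariant if $\mathrm{val}(ng)=\mathrm{val}(g)$ for all $g\in G$ and all integers $n>0$. For $\gamma<\infty$ the rib at $\gamma$ is $R_{G,\gamma}=\{x\mid\mathrm{val}(x)\ge\gamma\}/\{x\mid\mathrm{val}(x)>\gamma\}$. An extension $H/G$ means a valued abelian group $H$ containing $G$ as a subgroup with $\Gamma_G\subseteq\Gamma_H$ as ordered sets and $\mathrm{val}_H$ extending $\mathrm{val}_G$; it is immediate if $\Gamma_G=\Gamma_H$ and the natural embedding $R_{G,\gamma}\to R_{H,\gamma}$ is onto for all $\gamma\in\Gamma_G\setminus\{\infty\}$. $H/G$ is maximal if no valued group $K$ with $G\subsetneq K\subseteq H$ is an immediate extension of $G$. $G$ is maximal if it has no proper immediate extension. A sequence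 $(a_i)_{i\in I}$ in $G$, with $I$ well-ordered without maximum, is pseudo-Cauchy if there is $\alpha\in I$ such that $\mathrm{val}(a_i-a_j)<\mathrm{val}(a_j-a_k)$ for all $\alpha<i<j<k$. An element $a$ is a pseudo-limit of a pseudo-Cauchy sequence $(a_i)_{i\in I}$ if there is $\alpha\in I$ with $\mathrm{val}(a_i-a)=\mathrm{val}(a_i-a_j)$ for all $\alpha<i<j$. $G$ is pseudo-complete if every pseudo-Cauchy sequence in $G$ has a pseudo-limit in $G$; $H/G$ is pseudo-complete if every pseudo-Cauchy sequence in $G$ admitting a pseudo-limit in $H$ admits a pseudo-limit in $G$. *)

theory Defs
  imports "HOL-Algebra.Coset"
begin

text \<open>
  Groups are written multiplicatively, following \<open>HOL-Algebra\<close>: the additive \<open>g - h\<close>, \<open>ng\<close> and \<open>0\<close>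
  appear as \<open>g \<otimes> inv h\<close>, \<open>g [^] n\<close> and \<open>\<one>\<close>. Since the valuation is onto, the value set is the
  image of the carrier. It lies in a linearly ordered type whose greatest element \<open>top_class.top\<close> plays the
  role of \<open>\<infinity>\<close>.
\<close>

record ('a, 'v) vgroup = "'a monoid" +
  val :: "'a \<Rightarrow> 'v"

locale valued_group = comm_group G
  for G :: "('a, 'v::{linorder,order_top}) vgroup" (structure) +
  assumes val_eq_top: "x \<in> carrier G \<Longrightarrow> val G x = top_class.top \<longleftrightarrow> x = \<one>"
    and val_diff: "\<lbrakk>x \<in> carrier G; y \<in> carrier G\<rbrakk>
          \<Longrightarrow> min (val G x) (val G y) \<le> val G (x \<otimes> inv y)"

definition value_set :: "('a, 'v) vgroup \<Rightarrow> 'v set" where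
  "value_set G = val G ` carrier G"

definition Z_invariant :: "('a, 'v) vgroup \<Rightarrow> bool" where
  "Z_invariant G \<longleftrightarrow>
     (\<forall>g\<in>carrier G. \<forall>n::int. n > 0 \<longrightarrow> val G (g [^]\<^bsub>G\<^esub> n) = val G g)"

definition Delta :: "('a, 'v) vgroup \<Rightarrow> nat \<Rightarrow> 'a \<Rightarrow> 'v set" where
  "Delta G m g = {val G (g \<otimes>\<^bsub>G\<^esub> inv\<^bsub>G\<^esub> (g' [^]\<^bsub>G\<^esub> m)) | g'. g' \<in> carrier G}"

definition has_maximum :: "'v::order set \<Rightarrow> bool" where
  "has_maximum S \<longleftrightarrow> (\<exists>s\<in>S. \<forall>t\<in>S. t \<le> s)"


subsection \<open>Extensions\<close>

definition val_ge :: "('a, 'v::order) vgroup \<Rightarrow> 'v \<Rightarrow> 'a set" where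
  "val_ge G \<gamma> = {x \<in> carrier G. \<gamma> \<le> val G x}"

definition val_gt :: "('a, 'v::order) vgroup \<Rightarrow> 'v \<Rightarrow> 'a set" where
  "val_gt G \<gamma> = {x \<in> carrier G. \<gamma> < val G x}"

definition rib :: "('a, 'v::order) vgroup \<Rightarrow> 'v \<Rightarrow> 'a set monoid" where
  "rib G \<gamma> = G\<lparr>carrier := val_ge G \<gamma>\<rparr> Mod val_gt G \<gamma>"

text \<open>
  The natural embedding of ribs for a subgroup \<open>G\<close> of \<open>H\<close>: it sends the coset of \<open>x\<close> modulo
  \<open>val_gt G \<gamma>\<close> to the coset of \<open>x\<close> modulo \<open>val_gt H \<gamma>\<close>, i.e. a coset \<open>X\<close> to its saturation.
\<close>
definition rib_map :: "('a, 'v::order) vgroup \<Rightarrow> 'v \<Rightarrow> 'a set \<Rightarrow> 'a set" where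
  "rib_map H \<gamma> X = val_gt H \<gamma> <#>\<^bsub>H\<^esub> X"

text \<open>
  The inclusion of value sets and the agreement of their orders are automatic here: both value sets
  are subsets of the same ordered type, and the valuations agree on \<open>G\<close>.
\<close>
definition extension :: "('a, 'v::{linorder,order_top}) vgroup \<Rightarrow> ('a, 'v) vgroup \<Rightarrow> bool" where
  "extension G H \<longleftrightarrow> valued_group G \<and> valued_group H \<and> carrier G \<subseteq> carrier H \<and>
     (\<forall>x\<in>carrier G. \<forall>y\<in>carrier G. x \<otimes>\<^bsub>G\<^esub> y = x \<otimes>\<^bsub>H\<^esub> y) \<and>
     (\<forall>x\<in>carrier G. val G x = val H x)"

definition immediate_extension ::
    "('a, 'v::{linorder,order_top}) vgroup \<Rightarrow> ('a, 'v) vgroup \<Rightarrow> bool" where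
  "immediate_extension G H \<longleftrightarrow> extension G H \<and> value_set G = value_set H \<and>
     (\<forall>\<gamma>\<in>value_set G - {top_class.top}. rib_map H \<gamma> ` carrier (rib G \<gamma>) = carrier (rib H \<gamma>))"

definition maximal_in ::
    "('a, 'v::{linorder,order_top}) vgroup \<Rightarrow> ('a, 'v) vgroup \<Rightarrow> bool" where
  "maximal_in G H \<longleftrightarrow>
     \<not> (\<exists>K. immediate_extension G K \<and> extension K H \<and> carrier G \<subset> carrier K)"

definition val_iso ::
    "('a, 'v) vgroup \<Rightarrow> ('b, 'v) vgroup \<Rightarrow> ('a \<Rightarrow> 'b) set" where
  "val_iso G G' = {f \<in> iso G G'. \<forall>x\<in>carrier G. val G' (f x) = val G x}"

text \<open>
  A maximal group has no proper immediate extension. The carrier of such an extension need not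
  fit into the type of the carrier of \<open>G\<close>, so extensions of isomorphic copies of \<open>G\<close> are considered.
  The type \<open>'a \<times> int\<close> is large enough for them: by \<open>maximal_no_immediate_extension\<close> below, a maximal
  group has no proper immediate extension with carrier in any type whatsoever. The type of values
  need not vary, because an immediate extension has the same value set.
\<close>
definition maximal :: "('a, 'v::{linorder,order_top}) vgroup \<Rightarrow> bool" where
  "maximal G \<longleftrightarrow>
     \<not> (\<exists>(G' :: ('a \<times> int, 'v) vgroup) H f.
          f \<in> val_iso G G' \<and> immediate_extension G' H \<and> carrier G' \<subset> carrier H)"


subsection \<open>Pseudo-Cauchy sequences\<close>

text \<open>
  An index set \<open>I\<close> is the field of a well-order \<open>r\<close>, given as a non-strict relation.
\<close>
definition index_order :: "'i rel \<Rightarrow> bool" where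
  "index_order r \<longleftrightarrow> Well_order r \<and> (\<forall>i\<in>Field r. \<exists>j. (i, j) \<in> r - Id)"

definition pseudo_cauchy ::
    "('a, 'v::linorder) vgroup \<Rightarrow> 'i rel \<Rightarrow> ('i \<Rightarrow> 'a) \<Rightarrow> bool" where
  "pseudo_cauchy G r a \<longleftrightarrow> index_order r \<and> (\<forall>i\<in>Field r. a i \<in> carrier G) \<and>
     (\<exists>\<alpha>\<in>Field r. \<forall>i j k. (\<alpha>, i) \<in> r - Id \<and> (i, j) \<in> r - Id \<and> (j, k) \<in> r - Id \<longrightarrow>
        val G (a i \<otimes>\<^bsub>G\<^esub> inv\<^bsub>G\<^esub> (a j)) < val G (a j \<otimes>\<^bsub>G\<^esub> inv\<^bsub>G\<^esub> (a k)))"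

definition pseudo_limit ::
    "('a, 'v::linorder) vgroup \<Rightarrow> 'i rel \<Rightarrow> ('i \<Rightarrow> 'a) \<Rightarrow> 'a \<Rightarrow> bool" where
  "pseudo_limit G r a x \<longleftrightarrow> x \<in> carrier G \<and>
     (\<exists>\<alpha>\<in>Field r. \<forall>i j. (\<alpha>, i) \<in> r - Id \<and> (i, j) \<in> r - Id \<longrightarrow>
        val G (a i \<otimes>\<^bsub>G\<^esub> inv\<^bsub>G\<^esub> x) = val G (a i \<otimes>\<^bsub>G\<^esub> inv\<^bsub>G\<^esub> (a j)))"

text \<open>
  In the next two definitions the index sets range over all well-orders on subsets of the type of
  the carrier. This captures arbitrary index sets, because a tail of a pseudo-Cauchy sequence
  is injective; see \<open>pseudo_complete_any_index\<close> and \<open>pseudo_complete_in_any_index\<close> below.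
\<close>
definition pseudo_complete :: "('a, 'v::linorder) vgroup \<Rightarrow> bool" where
  "pseudo_complete G \<longleftrightarrow>
     (\<forall>(r :: 'a rel) a. pseudo_cauchy G r a \<longrightarrow> (\<exists>x. pseudo_limit G r a x))"

definition pseudo_complete_in :: "('a, 'v::linorder) vgroup \<Rightarrow> ('a, 'v) vgroup \<Rightarrow> bool" where
  "pseudo_complete_in G H \<longleftrightarrow>
     (\<forall>(r :: 'a rel) a. pseudo_cauchy G r a \<and> (\<exists>x. pseudo_limit H r a x) \<longrightarrow>
        (\<exists>x. pseudo_limit G r a x))"


subsection \<open>Independence of the choice of types\<close>

lemma (in valued_group) pseudo_cauchy_reindex:
  fixes r :: "'i rel"
  assumes "pseudo_cauchy G r a"
  obtains r' :: "'a rel" where "pseudo_cauchy G r' id"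
    and "\<And>(H :: ('a, 'v) vgroup) x. pseudo_limit H r' id x \<longleftrightarrow> pseudo_limit H r a x"
proof -
  have wo: "Well_order r" and nomax: "\<And>i. i \<in> Field r \<Longrightarrow> \<exists>j. (i, j) \<in> r - Id"
    and carr: "\<And>i. i \<in> Field r \<Longrightarrow> a i \<in> carrier G"
    using assms by (auto simp: pseudo_cauchy_def index_order_def)
  obtain \<alpha> where \<alpha>: "\<alpha> \<in> Field r" and inc:
    "\<And>i j k. \<lbrakk>(\<alpha>, i) \<in> r - Id; (i, j) \<in> r - Id; (j, k) \<in> r - Id\<rbrakk>
      \<Longrightarrow> val G (a i \<otimes> inv (a j)) < val G (a j \<otimes> inv (a k))"
    using assms unfolding pseudo_cauchy_def by blast
  have tr: "trans r" and an: "antisym r" and rf: "refl_on (Field r) r" and tot: "Total r"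
    using wo unfolding order_on_defs by blast+
  have strict_trans: "(i, k) \<in> r - Id" if "(i, j) \<in> r - Id" "(j, k) \<in> r - Id" for i j k
    using that tr an by (auto dest: transD antisymD)
  define J where "J = {i. (\<alpha>, i) \<in> r - Id}"
  have JF: "J \<subseteq> Field r" by (auto simp: J_def Field_def)
  have inj: "inj_on a J"
  proof (rule inj_onI, rule ccontr)
    have *: False if ij: "(i, j) \<in> r - Id" "i \<in> J" "j \<in> J" "a i = a j" for i j
    proof -
      obtain k where k: "(j, k) \<in> r - Id" using nomax ij JF by blast
      have "val G (a i \<otimes> inv (a j)) < val G (a j \<otimes> inv (a k))"
        using inc[of i j k] ij(1,2) k by (simp only: J_def mem_Collect_eq)
      moreover have "a i \<otimes> inv (a j) = \<one>" using carr ij JF by auto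
      ultimately show False using val_eq_top[of \<one>] by (auto simp: less_le top_unique)
    qed
    fix i j assume "i \<in> J" "j \<in> J" "a i = a j" "i \<noteq> j"
    moreover from this have "(i, j) \<in> r - Id \<or> (j, i) \<in> r - Id"
      using tot JF unfolding total_on_def by blast
    ultimately show False using *[of i j] *[of j i] by auto
  qed
  define s where "s = Restr r J"
  define r' where "r' = dir_image s a"
  have Fs: "Field s = J"
    unfolding s_def using rf JF by (subst Refl_Field_Restr) (auto simp: )
  have Fr': "Field r' = a ` J" by (simp add: r'_def dir_image_Field Fs)
  have mem: "(a i, a j) \<in> r' - Id \<longleftrightarrow> (i, j) \<in> r - Id" if "i \<in> J" "j \<in> J" for i j
    using inj that unfolding r'_def dir_image_def s_def inj_on_def by auto
  have r'E: "\<exists>i j. i \<in> J \<and> j \<in> J \<and> x = a i \<and> y = a j \<and> (i, j) \<in> r - Id"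
    if "(x, y) \<in> r' - Id" for x y
    using that unfolding r'_def dir_image_def s_def by auto
  have up: "j \<in> J" if "i \<in> J" "(i, j) \<in> r - Id" for i j
    using that strict_trans unfolding J_def by blast
  have wo': "Well_order r'"
    unfolding r'_def
  proof (rule Well_order_dir_image)
    show "Well_order s" using Well_order_Restr[OF wo] by (simp add: s_def)
    show "inj_on a (Field s)" using inj by (simp only: Fs)
  qed
  have idx: "index_order r'"
    unfolding index_order_def
  proof (intro conjI ballI wo')
    fix x assume "x \<in> Field r'"
    then obtain i where i: "i \<in> J" "x = a i" by (auto simp: Fr')
    then obtain j where "(i, j) \<in> r - Id" using nomax JF by blast
    then show "\<exists>y. (x, y) \<in> r' - Id" using mem i up by blast
  qed
  obtain \<beta> where \<beta>: "\<beta> \<in> J" using nomax[OF \<alpha>] by (auto simp: J_def)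
  have pc: "pseudo_cauchy G r' id"
    unfolding pseudo_cauchy_def
  proof (intro conjI ballI idx)
    fix x assume "x \<in> Field r'"
    then show "id x \<in> carrier G" using carr JF by (auto simp: Fr')
  next
    show "\<exists>\<alpha>\<in>Field r'. \<forall>i j k. (\<alpha>, i) \<in> r' - Id \<and> (i, j) \<in> r' - Id \<and> (j, k) \<in> r' - Id \<longrightarrow>
        val G (id i \<otimes> inv (id j)) < val G (id j \<otimes> inv (id k))"
    proof (intro bexI[of _ "a \<beta>"] allI impI)
      show "a \<beta> \<in> Field r'" using \<beta> by (simp add: Fr')
      fix x y z assume *: "(a \<beta>, x) \<in> r' - Id \<and> (x, y) \<in> r' - Id \<and> (y, z) \<in> r' - Id"
      then obtain i j where ij: "i \<in> J" "j \<in> J" "x = a i" "y = a j" "(i, j) \<in> r - Id"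
        using r'E by blast
      obtain j' k where jk: "j' \<in> J" "k \<in> J" "y = a j'" "z = a k" "(j', k) \<in> r - Id"
        using * r'E by blast
      have "j' = j" using ij jk inj by (auto dest: inj_onD)
      then show "val G (id x \<otimes> inv (id y)) < val G (id y \<otimes> inv (id z))"
        using ij jk inc[of i j k] by (simp add: J_def)
    qed
  qed
  have lim: "pseudo_limit H r' id x \<longleftrightarrow> pseudo_limit H r a x" for H :: "('a, 'v) vgroup" and x
  proof
    assume L: "pseudo_limit H r' id x"
    then obtain b where b: "b \<in> J" and P: "\<And>y z. \<lbrakk>(a b, y) \<in> r' - Id; (y, z) \<in> r' - Id\<rbrakk>
        \<Longrightarrow> val H (y \<otimes>\<^bsub>H\<^esub> inv\<^bsub>H\<^esub> x) = val H (y \<otimes>\<^bsub>H\<^esub> inv\<^bsub>H\<^esub> z)"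
      unfolding pseudo_limit_def Fr' by auto
    show "pseudo_limit H r a x"
      unfolding pseudo_limit_def
    proof (intro conjI bexI[of _ b] allI impI)
      show "x \<in> carrier H" using L by (simp add: pseudo_limit_def)
      show "b \<in> Field r" using b JF by auto
      fix i j assume *: "(b, i) \<in> r - Id \<and> (i, j) \<in> r - Id"
      then have "i \<in> J" "j \<in> J" using up b by blast+
      then show "val H (a i \<otimes>\<^bsub>H\<^esub> inv\<^bsub>H\<^esub> x) = val H (a i \<otimes>\<^bsub>H\<^esub> inv\<^bsub>H\<^esub> (a j))"
        using P * mem b by blast
    qed
  next
    assume L: "pseudo_limit H r a x"
    then obtain b0 where b0: "b0 \<in> Field r" and P: "\<And>y z. \<lbrakk>(b0, y) \<in> r - Id; (y, z) \<in> r - Id\<rbrakk>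
        \<Longrightarrow> val H (a y \<otimes>\<^bsub>H\<^esub> inv\<^bsub>H\<^esub> x) = val H (a y \<otimes>\<^bsub>H\<^esub> inv\<^bsub>H\<^esub> (a z))"
      unfolding pseudo_limit_def by auto
    obtain b where b: "b \<in> J" "\<And>k. (b, k) \<in> r - Id \<Longrightarrow> (b0, k) \<in> r - Id"
    proof (cases "b0 \<in> J")
      case False
      then have "(b0, \<alpha>) \<in> r"
        using tot refl_onD[OF rf \<alpha>] \<alpha> b0 unfolding total_on_def J_def by (cases "b0 = \<alpha>") auto
      then have "(b0, k) \<in> r - Id" if "(\<alpha>, k) \<in> r - Id" for k
        using strict_trans[of b0 \<alpha> k] that by (cases "b0 = \<alpha>") auto
      then show ?thesis using that[of \<beta>] \<beta> strict_trans unfolding J_def by blast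
    qed blast
    show "pseudo_limit H r' id x"
      unfolding pseudo_limit_def
    proof (intro conjI bexI[of _ "a b"] allI impI)
      show "x \<in> carrier H" using L by (simp add: pseudo_limit_def)
      show "a b \<in> Field r'" using b by (simp add: Fr')
      fix y z assume *: "(a b, y) \<in> r' - Id \<and> (y, z) \<in> r' - Id"
      then obtain i j where ij: "i \<in> J" "j \<in> J" "y = a i" "z = a j" "(i, j) \<in> r - Id"
        using r'E by blast
      then show "val H (id y \<otimes>\<^bsub>H\<^esub> inv\<^bsub>H\<^esub> x) = val H (id y \<otimes>\<^bsub>H\<^esub> inv\<^bsub>H\<^esub> (id z))"
        using * mem[of b i] b P by auto
    qed
  qed
  show thesis using that[OF pc lim] .
qed

lemma pseudo_complete_any_index:
  fixes r :: "'i rel" and G :: "('a, 'v::{linorder,order_top}) vgroup"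
  assumes "valued_group G" "pseudo_complete G" "pseudo_cauchy G r a"
  shows "\<exists>x. pseudo_limit G r a x"
  using valued_group.pseudo_cauchy_reindex[OF assms(1,3)] assms(2)
  unfolding pseudo_complete_def by metis

lemma pseudo_complete_in_any_index:
  fixes r :: "'i rel" and G :: "('a, 'v::{linorder,order_top}) vgroup"
  assumes "valued_group G" "pseudo_complete_in G H" "pseudo_cauchy G r a"
    "\<exists>x. pseudo_limit H r a x"
  shows "\<exists>x. pseudo_limit G r a x"
  using valued_group.pseudo_cauchy_reindex[OF assms(1,3)] assms(2,4)
  unfolding pseudo_complete_in_def by metis

context valued_group
begin

lemma val_one: "val G \<one> = top_class.top"
  by (simp add: val_eq_top)

lemma val_inv_le: "x \<in> carrier G \<Longrightarrow> val G x \<le> val G (inv x)"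
  using val_diff[of \<one> x] by (simp add: val_one)

lemma val_inv: "x \<in> carrier G \<Longrightarrow> val G (inv x) = val G x"
  using val_inv_le[of x] val_inv_le[of "inv x"] by simp

lemma val_mult: "x \<in> carrier G \<Longrightarrow> y \<in> carrier G \<Longrightarrow> min (val G x) (val G y) \<le> val G (x \<otimes> y)"
  using val_diff[of x "inv y"] by (simp add: val_inv)

lemma val_eq_if_close:
  assumes "x \<in> carrier G" "y \<in> carrier G" "val G y < val G (y \<otimes> inv x)"
  shows "val G x = val G y"
proof -
  have "(y \<otimes> inv x) \<otimes> x = y"
    using assms by (simp add: m_assoc)
  moreover from this have "inv (y \<otimes> inv x) \<otimes> y = x"
    using assms by (metis inv_closed inv_solve_left m_closed)
  ultimately have "inv (y \<otimes> inv x) \<otimes> y = x" "(y \<otimes> inv x) \<otimes> x = y" by simp_all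
  then show ?thesis
    using val_mult[of "inv (y \<otimes> inv x)" y] val_mult[of "y \<otimes> inv x" x] assms
    by (auto simp: val_inv min_def split: if_splits)
qed

lemma val_gt_subgroup: "\<gamma> \<noteq> top_class.top \<Longrightarrow> subgroup (val_gt G \<gamma>) G"
proof (unfold_locales)
  fix x y assume "x \<in> val_gt G \<gamma>" "y \<in> val_gt G \<gamma>"
  then show "x \<otimes> y \<in> val_gt G \<gamma>"
    using val_mult[of x y] by (auto simp: val_gt_def min_def split: if_splits)
qed (auto simp: val_gt_def val_one val_inv less_top)

end

lemma carrier_rib: "carrier (rib G \<gamma>) = (\<lambda>x. val_gt G \<gamma> #>\<^bsub>G\<^esub> x) ` val_ge G \<gamma>"
  by (simp add: rib_def carrier_FactGroup r_coset_def)

lemma extension_one: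
  assumes "extension G H" shows "\<one>\<^bsub>G\<^esub> = \<one>\<^bsub>H\<^esub>"
proof -
  interpret G: valued_group G using assms by (simp add: extension_def)
  interpret H: valued_group H using assms by (simp add: extension_def)
  have "\<one>\<^bsub>G\<^esub> \<in> carrier H" "\<one>\<^bsub>G\<^esub> \<otimes>\<^bsub>H\<^esub> \<one>\<^bsub>G\<^esub> = \<one>\<^bsub>G\<^esub>"
    using assms G.one_closed G.l_one[OF G.one_closed] unfolding extension_def by (blast, metis)
  then show ?thesis by (metis H.l_cancel_one')
qed

lemma extension_inv:
  assumes "extension G H" "x \<in> carrier G" shows "inv\<^bsub>G\<^esub> x = inv\<^bsub>H\<^esub> x"
proof -
  interpret G: valued_group G using assms by (simp add: extension_def)
  interpret H: valued_group H using assms by (simp add: extension_def)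
  have "inv\<^bsub>G\<^esub> x \<otimes>\<^bsub>H\<^esub> x = \<one>\<^bsub>H\<^esub>"
    using assms extension_one[OF assms(1)] G.l_inv[OF assms(2)] G.inv_closed[OF assms(2)]
    unfolding extension_def by metis
  then have "inv\<^bsub>H\<^esub> x = inv\<^bsub>G\<^esub> x"
    by (rule H.inv_equality) (use assms G.inv_closed[OF assms(2)] in \<open>auto simp: extension_def\<close>)
  then show ?thesis by simp
qed

lemma extension_subgroup:
  assumes "extension G H" shows "subgroup (carrier G) H"
proof -
  interpret G: valued_group G using assms by (simp add: extension_def)
  interpret H: valued_group H using assms by (simp add: extension_def)
  show ?thesis
  proof (unfold_locales)
    fix x y assume "x \<in> carrier G" "y \<in> carrier G"
    then show "x \<otimes>\<^bsub>H\<^esub> y \<in> carrier G" using assms G.m_closed[of x y] by (simp add: extension_def)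
  next
    show "\<one>\<^bsub>H\<^esub> \<in> carrier G" using G.one_closed extension_one[OF assms] by simp
  next
    fix x assume "x \<in> carrier G"
    then show "inv\<^bsub>H\<^esub> x \<in> carrier G" using G.inv_closed extension_inv[OF assms] by metis
  qed (use assms in \<open>auto simp: extension_def\<close>)
qed

lemma rib_map_coset:
  assumes ext: "extension G H" and \<gamma>: "\<gamma> \<noteq> top_class.top" and x: "x \<in> carrier G"
  shows "rib_map H \<gamma> (val_gt G \<gamma> #>\<^bsub>G\<^esub> x) = val_gt H \<gamma> #>\<^bsub>H\<^esub> x"
proof -
  interpret G: valued_group G using ext by (simp add: extension_def)
  interpret H: valued_group H using ext by (simp add: extension_def)
  have mult: "w \<otimes>\<^bsub>G\<^esub> x = w \<otimes>\<^bsub>H\<^esub> x" and sub: "w \<in> val_gt H \<gamma>" if "w \<in> val_gt G \<gamma>" for w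
    using that ext x by (auto simp: extension_def val_gt_def)
  interpret S: subgroup "val_gt H \<gamma>" H using \<gamma> by (rule H.val_gt_subgroup)
  have xH: "x \<in> carrier H" using x ext by (auto simp: extension_def)
  have "\<one>\<^bsub>G\<^esub> \<in> val_gt G \<gamma>" using G.val_gt_subgroup[OF \<gamma>] by (rule subgroup.one_closed)
  then have one: "\<one>\<^bsub>H\<^esub> \<in> val_gt G \<gamma>" by (simp add: extension_one[OF ext])
  show ?thesis
  proof (rule equalityI; rule subsetI)
    fix z assume "z \<in> rib_map H \<gamma> (val_gt G \<gamma> #>\<^bsub>G\<^esub> x)"
    then obtain u w where uw: "u \<in> val_gt H \<gamma>" "w \<in> val_gt G \<gamma>" "z = u \<otimes>\<^bsub>H\<^esub> (w \<otimes>\<^bsub>H\<^esub> x)"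
      by (auto simp: rib_map_def set_mult_def r_coset_def mult)
    then have "z = (u \<otimes>\<^bsub>H\<^esub> w) \<otimes>\<^bsub>H\<^esub> x" using sub xH by (simp add: H.m_assoc)
    moreover have "u \<otimes>\<^bsub>H\<^esub> w \<in> val_gt H \<gamma>" using uw sub by simp
    ultimately show "z \<in> val_gt H \<gamma> #>\<^bsub>H\<^esub> x" by (auto simp: r_coset_def)
  next
    fix z assume "z \<in> val_gt H \<gamma> #>\<^bsub>H\<^esub> x"
    then obtain u where u: "u \<in> val_gt H \<gamma>" "z = u \<otimes>\<^bsub>H\<^esub> (\<one>\<^bsub>H\<^esub> \<otimes>\<^bsub>H\<^esub> x)"
      using xH by (auto simp: r_coset_def)
    then show "z \<in> rib_map H \<gamma> (val_gt G \<gamma> #>\<^bsub>G\<^esub> x)"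
      using one mult[OF one] unfolding rib_map_def set_mult_def r_coset_def by force
  qed
qed

lemma immediate_extension_iff:
  assumes ext: "extension G H"
  shows "immediate_extension G H \<longleftrightarrow>
    (\<forall>h\<in>carrier H. h \<noteq> \<one>\<^bsub>H\<^esub> \<longrightarrow> (\<exists>g\<in>carrier G. val H h < val H (h \<otimes>\<^bsub>H\<^esub> inv\<^bsub>H\<^esub> g)))"
    (is "_ \<longleftrightarrow> ?R")
proof -
  interpret G: valued_group G using ext by (simp add: extension_def)
  interpret H: valued_group H using ext by (simp add: extension_def)
  have GH: "x \<in> carrier H" "val G x = val H x" if "x \<in> carrier G" for x
    using that ext by (auto simp: extension_def)
  have img: "rib_map H \<gamma> ` carrier (rib G \<gamma>) = (\<lambda>x. val_gt H \<gamma> #>\<^bsub>H\<^esub> x) ` val_ge G \<gamma>"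
    if "\<gamma> \<noteq> top_class.top" for \<gamma>
    unfolding carrier_rib image_image
    by (intro image_cong refl rib_map_coset[OF ext that]) (simp add: val_ge_def)
  show ?thesis
  proof
    assume im: "immediate_extension G H"
    show ?R
    proof (intro ballI impI)
      fix h assume h: "h \<in> carrier H" "h \<noteq> \<one>\<^bsub>H\<^esub>"
      define \<gamma> where "\<gamma> = val H h"
      have \<gamma>: "\<gamma> \<noteq> top_class.top" using h by (simp add: \<gamma>_def H.val_eq_top)
      interpret S: subgroup "val_gt H \<gamma>" H using \<gamma> by (rule H.val_gt_subgroup)
      have "\<gamma> \<in> value_set G" using im h by (auto simp: immediate_extension_def value_set_def \<gamma>_def)
      then have "(\<lambda>x. val_gt H \<gamma> #>\<^bsub>H\<^esub> x) ` val_ge G \<gamma> = (\<lambda>x. val_gt H \<gamma> #>\<^bsub>H\<^esub> x) ` val_ge H \<gamma>"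
        using im \<gamma> img by (simp add: immediate_extension_def carrier_rib[of H])
      moreover have "h \<in> val_ge H \<gamma>" using h by (simp add: val_ge_def \<gamma>_def)
      ultimately obtain g where g: "g \<in> val_ge G \<gamma>" "val_gt H \<gamma> #>\<^bsub>H\<^esub> h = val_gt H \<gamma> #>\<^bsub>H\<^esub> g"
        by (metis (no_types, lifting) image_iff)
      have "h \<in> val_gt H \<gamma> #>\<^bsub>H\<^esub> h" using h H.rcos_self S.subgroup_axioms by blast
      then obtain u where u: "u \<in> val_gt H \<gamma>" "h = u \<otimes>\<^bsub>H\<^esub> g"
        unfolding g(2) by (auto simp: r_coset_def)
      have gG: "g \<in> carrier G" using g by (simp add: val_ge_def)
      have "u \<in> carrier H" "g \<in> carrier H" using S.mem_carrier[OF u(1)] GH(1)[OF gG] by blast+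
      then have "h \<otimes>\<^bsub>H\<^esub> inv\<^bsub>H\<^esub> g = u" unfolding u(2) by (simp add: H.m_assoc)
      moreover have "val H h < val H u" using u(1) unfolding val_gt_def \<gamma>_def by blast
      ultimately show "\<exists>g\<in>carrier G. val H h < val H (h \<otimes>\<^bsub>H\<^esub> inv\<^bsub>H\<^esub> g)"
        using gG by metis
    qed
  next
    assume R: ?R
    have same: "\<exists>x\<in>carrier G. val H x = val H y" if y: "y \<in> carrier H" for y
    proof (cases "y = \<one>\<^bsub>H\<^esub>")
      case True
      then show ?thesis using G.one_closed extension_one[OF ext] by metis
    next
      case False
      then show ?thesis using R y H.val_eq_if_close GH by metis
    qed
    have "value_set G = value_set H"
    proof
      show "value_set G \<subseteq> value_set H" using GH by (auto simp: value_set_def)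
      show "value_set H \<subseteq> value_set G"
      proof
        fix v assume "v \<in> value_set H"
        then obtain y where "y \<in> carrier H" "v = val H y" by (auto simp: value_set_def)
        moreover obtain x where "x \<in> carrier G" "val H x = val H y" using same calculation(1) by blast
        ultimately show "v \<in> value_set G" using GH(2)[of x] unfolding value_set_def by (metis image_eqI)
      qed
    qed
    moreover have "rib_map H \<gamma> ` carrier (rib G \<gamma>) = carrier (rib H \<gamma>)" if \<gamma>: "\<gamma> \<noteq> top_class.top" for \<gamma>
    proof -
      have 1: "val_ge G \<gamma> \<subseteq> val_ge H \<gamma>" using GH by (auto simp: val_ge_def)
      have 2: "\<exists>x\<in>val_ge G \<gamma>. val_gt H \<gamma> #>\<^bsub>H\<^esub> y = val_gt H \<gamma> #>\<^bsub>H\<^esub> x" if y: "y \<in> val_ge H \<gamma>" for y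
      proof -
        have yH: "y \<in> carrier H" "\<gamma> \<le> val H y" using y by (auto simp: val_ge_def)
        have "\<exists>x\<in>carrier G. \<gamma> \<le> val H x \<and> \<gamma> < val H (y \<otimes>\<^bsub>H\<^esub> inv\<^bsub>H\<^esub> x)"
        proof (cases "\<gamma> < val H y")
          case True
          then show ?thesis
            using G.one_closed yH by (intro bexI[of _ "\<one>\<^bsub>G\<^esub>"]) (auto simp: extension_one[OF ext] H.val_one)
        next
          case False
          then have "y \<noteq> \<one>\<^bsub>H\<^esub>" using \<gamma> yH by (auto simp: H.val_one less_top)
          then obtain x where x: "x \<in> carrier G" "val H y < val H (y \<otimes>\<^bsub>H\<^esub> inv\<^bsub>H\<^esub> x)"
            using R yH by blast
          then show ?thesis using H.val_eq_if_close[of x y] GH yH by (intro bexI[of _ x]) auto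
        qed
        then obtain x where x: "x \<in> carrier G" "\<gamma> \<le> val H x" "\<gamma> < val H (y \<otimes>\<^bsub>H\<^esub> inv\<^bsub>H\<^esub> x)" by blast
        have "y \<otimes>\<^bsub>H\<^esub> inv\<^bsub>H\<^esub> x \<in> val_gt H \<gamma>" using x yH GH by (simp add: val_gt_def)
        moreover have "y = (y \<otimes>\<^bsub>H\<^esub> inv\<^bsub>H\<^esub> x) \<otimes>\<^bsub>H\<^esub> x" using x yH GH by (simp add: H.m_assoc)
        ultimately have "y \<in> val_gt H \<gamma> #>\<^bsub>H\<^esub> x" by (auto simp: r_coset_def)
        then have "val_gt H \<gamma> #>\<^bsub>H\<^esub> x = val_gt H \<gamma> #>\<^bsub>H\<^esub> y"
          by (rule H.repr_independence) (use x GH \<gamma> H.val_gt_subgroup in auto)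
        then show ?thesis using x GH by (intro bexI[of _ x]) (auto simp: val_ge_def)
      qed
      show ?thesis unfolding img[OF \<gamma>] carrier_rib[of H] using 1 2 by blast
    qed
    ultimately show "immediate_extension G H" using ext by (simp add: immediate_extension_def)
  qed
qed

definition transport :: "('b \<Rightarrow> 'c) \<Rightarrow> ('c \<Rightarrow> 'b) \<Rightarrow> ('b, 'v) vgroup \<Rightarrow> ('c, 'v) vgroup" where
  "transport s t K = \<lparr>carrier = s ` carrier K, mult = \<lambda>x y. s (t x \<otimes>\<^bsub>K\<^esub> t y), one = s \<one>\<^bsub>K\<^esub>,
     val = \<lambda>x. val K (t x)\<rparr>"

lemma transport_sel [simp]:
  "carrier (transport s t K) = s ` carrier K" "\<one>\<^bsub>transport s t K\<^esub> = s \<one>\<^bsub>K\<^esub>"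
  "x \<otimes>\<^bsub>transport s t K\<^esub> y = s (t x \<otimes>\<^bsub>K\<^esub> t y)" "val (transport s t K) x = val K (t x)"
  by (simp_all add: transport_def)

lemma transport_valued_group:
  assumes K: "valued_group K" and ts: "\<And>x. x \<in> carrier K \<Longrightarrow> t (s x) = x"
  shows "valued_group (transport s t K)"
    and "x \<in> carrier K \<Longrightarrow> inv\<^bsub>transport s t K\<^esub> (s x) = s (inv\<^bsub>K\<^esub> x)"
proof -
  interpret K: valued_group K by fact
  have "comm_group (transport s t K)"
  proof (rule comm_groupI)
    fix x assume "x \<in> carrier (transport s t K)"
    then show "\<exists>y\<in>carrier (transport s t K). y \<otimes>\<^bsub>transport s t K\<^esub> x = \<one>\<^bsub>transport s t K\<^esub>"
      by (auto simp: ts intro!: bexI[of _ "inv\<^bsub>K\<^esub> _"])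
  qed (auto simp: ts K.m_ac)
  then interpret T: comm_group "transport s t K" .
  show inv: "inv\<^bsub>transport s t K\<^esub> (s x) = s (inv\<^bsub>K\<^esub> x)" if "x \<in> carrier K" for x
    using that by (intro T.inv_equality) (auto simp: ts)
  show "valued_group (transport s t K)"
  proof (unfold_locales)
    fix x assume "x \<in> carrier (transport s t K)"
    then obtain a where a: "a \<in> carrier K" "x = s a" by auto
    then have "x = s \<one>\<^bsub>K\<^esub> \<longleftrightarrow> a = \<one>\<^bsub>K\<^esub>" using ts K.one_closed by metis
    then show "val (transport s t K) x = top_class.top \<longleftrightarrow> x = \<one>\<^bsub>transport s t K\<^esub>"
      using a by (simp add: ts K.val_eq_top)
  next
    fix x y assume "x \<in> carrier (transport s t K)" "y \<in> carrier (transport s t K)"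
    then show "min (val (transport s t K) x) (val (transport s t K) y)
        \<le> val (transport s t K) (x \<otimes>\<^bsub>transport s t K\<^esub> inv\<^bsub>transport s t K\<^esub> y)"
      by (auto simp: ts inv K.val_diff simp del: min_le_iff_disj)
  qed
qed

lemma transport_immediate:
  assumes im: "immediate_extension G K" and ts: "\<And>x. x \<in> carrier K \<Longrightarrow> t (s x) = x"
  shows "immediate_extension (transport s t G) (transport s t K)"
proof -
  have ext: "extension G K" using im by (simp add: immediate_extension_def)
  have G: "valued_group G" and K: "valued_group K" and sub: "carrier G \<subseteq> carrier K"
    using ext by (simp_all add: extension_def)
  interpret K: valued_group K by fact
  have tsG: "\<And>x. x \<in> carrier G \<Longrightarrow> t (s x) = x" using ts sub by auto
  have ext': "extension (transport s t G) (transport s t K)"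
    using ext transport_valued_group(1)[OF G, of t s] transport_valued_group(1)[OF K, of t s] ts
    by (auto simp: extension_def tsG)
  have R: "\<forall>h\<in>carrier K. h \<noteq> \<one>\<^bsub>K\<^esub> \<longrightarrow> (\<exists>g\<in>carrier G. val K h < val K (h \<otimes>\<^bsub>K\<^esub> inv\<^bsub>K\<^esub> g))"
    using im immediate_extension_iff[OF ext] by blast
  have inv: "inv\<^bsub>transport s t K\<^esub> (s x) = s (inv\<^bsub>K\<^esub> x)" if "x \<in> carrier K" for x
    by (rule transport_valued_group(2)) (fact K, fact ts, fact that)
  show ?thesis
    unfolding immediate_extension_iff[OF ext']
  proof (intro ballI impI)
    fix y assume y: "y \<in> carrier (transport s t K)" "y \<noteq> \<one>\<^bsub>transport s t K\<^esub>"
    then obtain h where h: "h \<in> carrier K" "y = s h" by auto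
    with y have "h \<noteq> \<one>\<^bsub>K\<^esub>" by auto
    then obtain g where g: "g \<in> carrier G" "val K h < val K (h \<otimes>\<^bsub>K\<^esub> inv\<^bsub>K\<^esub> g)" using R h by blast
    have gK: "g \<in> carrier K" using g sub by auto
    show "\<exists>g\<in>carrier (transport s t G). val (transport s t K) y
        < val (transport s t K) (y \<otimes>\<^bsub>transport s t K\<^esub> inv\<^bsub>transport s t K\<^esub> g)"
      using g gK h by (intro bexI[of _ "s g"]) (auto simp: ts inv)
  qed
qed

lemma immediate_simple_subextension:
  assumes im: "immediate_extension G H" and h: "h \<in> carrier H"
  defines "K \<equiv> H\<lparr>carrier := {g \<otimes>\<^bsub>H\<^esub> h [^]\<^bsub>H\<^esub> (k::int) | g k. g \<in> carrier G}\<rparr>"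
  shows "immediate_extension G K" "h \<in> carrier K"
proof -
  have ext: "extension G H" using im by (simp add: immediate_extension_def)
  interpret G: valued_group G using ext by (simp add: extension_def)
  interpret H: valued_group H using ext by (simp add: extension_def)
  interpret S: subgroup "carrier G" H by (rule extension_subgroup[OF ext])
  let ?C = "{g \<otimes>\<^bsub>H\<^esub> h [^]\<^bsub>H\<^esub> (k::int) | g k. g \<in> carrier G}"
  have Csub: "subgroup ?C H"
  proof (unfold_locales)
    show "?C \<subseteq> carrier H" using h by auto
    show "\<one>\<^bsub>H\<^esub> \<in> ?C" using h by (auto intro!: exI[of _ "\<one>\<^bsub>H\<^esub>"] exI[of _ "0::int"])
  next
    fix x y assume "x \<in> ?C" "y \<in> ?C"
    then obtain g k g' k' where *: "g \<in> carrier G" "g' \<in> carrier G"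
      "x = g \<otimes>\<^bsub>H\<^esub> h [^]\<^bsub>H\<^esub> (k::int)" "y = g' \<otimes>\<^bsub>H\<^esub> h [^]\<^bsub>H\<^esub> (k'::int)" by blast
    then have "x \<otimes>\<^bsub>H\<^esub> y = (g \<otimes>\<^bsub>H\<^esub> g') \<otimes>\<^bsub>H\<^esub> h [^]\<^bsub>H\<^esub> (k + k')"
      using h by (simp add: H.int_pow_mult H.m_ac)
    then show "x \<otimes>\<^bsub>H\<^esub> y \<in> ?C" using * S.m_closed by blast
  next
    fix x assume "x \<in> ?C"
    then obtain g k where *: "g \<in> carrier G" "x = g \<otimes>\<^bsub>H\<^esub> h [^]\<^bsub>H\<^esub> (k::int)" by blast
    then have "inv\<^bsub>H\<^esub> x = inv\<^bsub>H\<^esub> g \<otimes>\<^bsub>H\<^esub> h [^]\<^bsub>H\<^esub> (- k)"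
      using h by (simp add: H.inv_mult H.int_pow_neg)
    then show "inv\<^bsub>H\<^esub> x \<in> ?C" using * S.m_inv_closed by blast
  qed
  have Kcarr: "carrier K = ?C" by (simp add: K_def)
  have KH: "carrier K \<subseteq> carrier H" using subgroup.subset[OF Csub] by (simp add: K_def)
  have "group K" unfolding K_def by (intro H.subgroup_imp_group Csub)
  then interpret K: comm_group K
  proof (rule group.group_comm_groupI)
    fix x y assume "x \<in> carrier K" "y \<in> carrier K"
    then show "x \<otimes>\<^bsub>K\<^esub> y = y \<otimes>\<^bsub>K\<^esub> x" using KH H.m_comm[of x y] by (auto simp: K_def)
  qed
  have invK: "inv\<^bsub>K\<^esub> x = inv\<^bsub>H\<^esub> x" if "x \<in> carrier K" for x
    using that H.m_inv_consistent[OF Csub, of x] by (simp add: K_def)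
  have selK: "x \<otimes>\<^bsub>K\<^esub> y = x \<otimes>\<^bsub>H\<^esub> y" "\<one>\<^bsub>K\<^esub> = \<one>\<^bsub>H\<^esub>" "val K x = val H x" for x y
    by (simp_all add: K_def)
  have K: "valued_group K"
  proof unfold_locales
    fix x assume "x \<in> carrier K"
    then have "x \<in> carrier H" using KH by blast
    then show "val K x = top_class.top \<longleftrightarrow> x = \<one>\<^bsub>K\<^esub>" unfolding selK by (rule H.val_eq_top)
  next
    fix x y assume xy: "x \<in> carrier K" "y \<in> carrier K"
    then have "x \<in> carrier H" "y \<in> carrier H" using KH by blast+
    then show "min (val K x) (val K y) \<le> val K (x \<otimes>\<^bsub>K\<^esub> inv\<^bsub>K\<^esub> y)"
      unfolding selK invK[OF xy(2)] by (rule H.val_diff)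
  qed
  have GK: "carrier G \<subseteq> carrier K"
  proof
    fix g assume "g \<in> carrier G"
    then have "g = g \<otimes>\<^bsub>H\<^esub> h [^]\<^bsub>H\<^esub> (0::int)" by simp
    with \<open>g \<in> carrier G\<close> show "g \<in> carrier K" unfolding Kcarr by blast
  qed
  have extK: "extension G K"
    using ext K GK by (auto simp: extension_def selK)
  show "immediate_extension G K"
    unfolding immediate_extension_iff[OF extK]
  proof (intro ballI impI)
    fix x assume x: "x \<in> carrier K" "x \<noteq> \<one>\<^bsub>K\<^esub>"
    then have "x \<in> carrier H" "x \<noteq> \<one>\<^bsub>H\<^esub>" using KH selK(2) by auto
    then obtain g where g: "g \<in> carrier G" "val H x < val H (x \<otimes>\<^bsub>H\<^esub> inv\<^bsub>H\<^esub> g)"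
      using im unfolding immediate_extension_iff[OF ext] by blast
    then have "g \<in> carrier K" using GK by blast
    then show "\<exists>g\<in>carrier G. val K x < val K (x \<otimes>\<^bsub>K\<^esub> inv\<^bsub>K\<^esub> g)"
      using g by (intro bexI[of _ g]) (simp_all only: selK invK)
  qed
  have "h = \<one>\<^bsub>H\<^esub> \<otimes>\<^bsub>H\<^esub> h [^]\<^bsub>H\<^esub> (1::int)" using h by simp
  then show "h \<in> carrier K" unfolding Kcarr using S.one_closed by blast
qed

lemma maximal_no_immediate_extension:
  fixes G :: "('a, 'v::{linorder,order_top}) vgroup" and G' H :: "('b, 'v) vgroup"
  assumes "valued_group G" "maximal G" and f: "f \<in> val_iso G G'" and im: "immediate_extension G' H"
  shows "carrier G' = carrier H"
proof (rule ccontr)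
  assume "carrier G' \<noteq> carrier H"
  then obtain h where h: "h \<in> carrier H" "h \<notin> carrier G'"
    using im by (auto simp: immediate_extension_def extension_def)
  define K where "K = H\<lparr>carrier := {g \<otimes>\<^bsub>H\<^esub> h [^]\<^bsub>H\<^esub> (k::int) | g k. g \<in> carrier G'}\<rparr>"
  have imK: "immediate_extension G' K" and hK: "h \<in> carrier K"
    using immediate_simple_subextension[OF im h(1)] by (simp_all add: K_def)
  then have GK: "carrier G' \<subseteq> carrier K" by (simp add: immediate_extension_def extension_def)
  have fim: "f ` carrier G = carrier G'" using f by (auto simp: val_iso_def iso_def bij_betw_def)
  define t :: "'a \<times> int \<Rightarrow> 'b" where "t p = f (fst p) \<otimes>\<^bsub>H\<^esub> h [^]\<^bsub>H\<^esub> (snd p)" for p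
  define s where "s = (\<lambda>x. SOME p. t p = x)"
  have ts: "t (s x) = x" if "x \<in> carrier K" for x
  proof -
    obtain g k where "g \<in> carrier G'" "x = g \<otimes>\<^bsub>H\<^esub> h [^]\<^bsub>H\<^esub> (k::int)"
      using \<open>x \<in> carrier K\<close> by (auto simp: K_def)
    moreover from this obtain a where "g = f a" using fim by auto
    ultimately have "t (a, k) = x" by (simp add: t_def)
    then have "\<exists>p. t p = x" ..
    then show ?thesis unfolding s_def by (rule someI_ex)
  qed
  have tsG: "t (s x) = x" if "x \<in> carrier G'" for x using that ts GK by auto
  have "s \<circ> f \<in> val_iso G (transport s t G')"
  proof -
    have fG: "f x \<in> carrier G'" if "x \<in> carrier G" for x using that fim by auto
    have "bij_betw s (carrier G') (s ` carrier G')"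
      by (intro inj_on_imp_bij_betw inj_on_inverseI[of _ t] tsG)
    then have "bij_betw (s \<circ> f) (carrier G) (s ` carrier G')"
      using f by (auto simp: val_iso_def iso_def intro: bij_betw_trans)
    then show ?thesis using f fG
      by (auto simp: val_iso_def iso_def hom_def tsG)
  qed
  moreover have "immediate_extension (transport s t G') (transport s t K)"
    by (rule transport_immediate) (fact imK, fact ts)
  moreover have "carrier (transport s t G') \<subset> carrier (transport s t K)"
  proof -
    have "s h \<notin> s ` carrier G'" using ts[OF hK] tsG h(2) by (metis imageE)
    then show ?thesis using GK hK by auto
  qed
  ultimately show False using \<open>maximal G\<close> unfolding maximal_def by blast
qed

end

(*
  Let (a_i) be a pseudo-Cauchy sequence with gaps c_i = val (a_i - a_j) for j > i. The integers k such
  that (k a_i) has a limit g, in the weak sense that val (k a_i - g) >= c_i eventually, form a subgroup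
  of the integers. For any other k and any h in G, the value val (h + k a_i) is eventually constant and
  smaller than c_i. Hence an element b with val (b - a_i) >= c_i generates an immediate extension of G
  as soon as every nonzero k is of this kind, and the existence of maxima of the sets Delta_m(g)
  together with Z-invariance ensures this unless (a_i) itself has a limit in G. If there is no ambient
  H, one adjoins instead a formal element b with m b = g, where m generates the subgroup above and g
  is a limit of (m a_i). Conversely, an element b of a proper immediate extension of G has no best
  approximation in G, so it is a pseudo-limit of a sequence in G without pseudo-limit in G.
*)

theory Submission
  imports Defs "HOL-Algebra.Generated_Groups"
begin

subsection \<open>Valued groups\<close>

context valued_group
begin

text \<open>\<open>x\<close> and \<open>x \<otimes> y\<close> differ by \<open>inv y\<close>, whose
  value exceeds that of \<open>x\<close>, so \<open>val_eq_if_close\<close> applies.\<close>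

lemma val_mult_eq:
  assumes "x \<in> carrier G" "y \<in> carrier G" "val G x < val G y"
  shows "val G (x \<otimes> y) = val G x"
proof -
  have "x \<otimes> inv (x \<otimes> y) = inv y" using assms by (simp add: inv_mult flip: m_assoc)
  then show ?thesis
    using val_eq_if_close[of "x \<otimes> y" x] assms by (simp add: val_inv)
qed

lemma val_nat_pow_ge: "x \<in> carrier G \<Longrightarrow> val G x \<le> val G (x [^] (n::nat))"
proof (induction n)
  case (Suc n)
  then show ?case using val_mult[of "x [^] n" x] by simp
qed (simp add: val_one)

lemma val_int_pow_ge: "x \<in> carrier G \<Longrightarrow> val G x \<le> val G (x [^] (k::int))"
  by (cases k rule: int_cases2) (simp_all only: int_pow_int int_pow_neg_int val_inv nat_pow_closed val_nat_pow_ge)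

lemma val_minus_commute:
  assumes "x \<in> carrier G" "y \<in> carrier G"
  shows "val G (x \<otimes> inv y) = val G (y \<otimes> inv x)"
  using val_inv[of "x \<otimes> inv y"] assms by (simp add: inv_mult_group)

lemma diff_add_diff:
  assumes "x \<in> carrier G" "y \<in> carrier G" "z \<in> carrier G"
  shows "(x \<otimes> inv y) \<otimes> (y \<otimes> inv z) = x \<otimes> inv z"
proof -
  have "inv y \<otimes> (y \<otimes> inv z) = inv z" using assms by (simp flip: m_assoc)
  then show ?thesis using assms by (simp add: m_assoc)
qed

lemma mult_diff_cancel:
  assumes "x \<in> carrier G" "y \<in> carrier G" "z \<in> carrier G"
  shows "(x \<otimes> y) \<otimes> (z \<otimes> inv x) = y \<otimes> z"
proof -
  have "inv x \<otimes> (x \<otimes> y) = y" using assms by (simp flip: m_assoc)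
  then have "(z \<otimes> inv x) \<otimes> (x \<otimes> y) = z \<otimes> y" using assms by (simp add: m_assoc)
  then show ?thesis using assms by (simp add: m_comm)
qed

lemma mult_diff_mult:
  assumes "x \<in> carrier G" "y \<in> carrier G" "z \<in> carrier G" "w \<in> carrier G"
  shows "(x \<otimes> y) \<otimes> inv (z \<otimes> w) = (x \<otimes> inv z) \<otimes> (y \<otimes> inv w)"
  using assms m_lcomm[of y "inv z" "inv w"] by (simp add: inv_mult m_assoc)

lemma diff_diff_swap:
  assumes "x \<in> carrier G" "y \<in> carrier G" "z \<in> carrier G" "w \<in> carrier G"
  shows "(x \<otimes> inv y) \<otimes> inv (z \<otimes> inv w) = (x \<otimes> inv z) \<otimes> inv (y \<otimes> inv w)"
  using assms m_lcomm[of "inv y" "inv z" w] by (simp add: inv_mult m_assoc)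

lemma int_pow_diff_distrib:
  assumes "x \<in> carrier G" "y \<in> carrier G"
  shows "(x \<otimes> inv y) [^] (k::int) = x [^] k \<otimes> inv (y [^] k)"
  using assms by (simp add: int_pow_distrib int_pow_inv)

text \<open>Supplies both the group \<open>K\<close> of \<open>adjoin_limit\<close> and the copy
  \<open>G0\<close> of \<open>G\<close> inside the formal extension.\<close>

lemma valued_subgroup:
  assumes S: "subgroup S G"
  shows "extension (G\<lparr>carrier := S\<rparr>) G"
proof -
  let ?S = "G\<lparr>carrier := S\<rparr>"
  have SG: "x \<in> carrier G" if "x \<in> S" for x using subgroup.mem_carrier[OF S that] .
  have "group ?S" by (rule subgroup_imp_group[OF S])
  then interpret S: comm_group ?S
    by (rule group.group_comm_groupI) (simp add: SG m_comm)
  have "valued_group ?S"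
    by unfold_locales
      (simp_all add: m_inv_consistent[OF S] SG val_eq_top val_diff del: min_le_iff_disj)
  then show ?thesis
    using SG valued_group_axioms by (auto simp: extension_def)
qed

end

section \<open>Arithmetic and approximation in extensions\<close>

lemma extension_int_pow:
  assumes ext: "extension G H" and x: "x \<in> carrier G"
  shows "x [^]\<^bsub>G\<^esub> (k::int) = x [^]\<^bsub>H\<^esub> k"
proof -
  interpret G: valued_group G using ext by (simp add: extension_def)
  interpret H: valued_group H using ext by (simp add: extension_def)
  have "group_hom G H id"
    by unfold_locales (use ext in \<open>auto simp: extension_def hom_def\<close>)
  then show ?thesis using group_hom.hom_int_pow[of G H id x k] x by simp
qed

lemma extension_diff:
  assumes ext: "extension G H" and x: "x \<in> carrier G" and y: "y \<in> carrier G"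
  shows "x \<otimes>\<^bsub>G\<^esub> inv\<^bsub>G\<^esub> y = x \<otimes>\<^bsub>H\<^esub> inv\<^bsub>H\<^esub> y"
    "val G (x \<otimes>\<^bsub>G\<^esub> inv\<^bsub>G\<^esub> y) = val H (x \<otimes>\<^bsub>H\<^esub> inv\<^bsub>H\<^esub> y)"
proof -
  interpret G: valued_group G using ext by (simp add: extension_def)
  show 1: "x \<otimes>\<^bsub>G\<^esub> inv\<^bsub>G\<^esub> y = x \<otimes>\<^bsub>H\<^esub> inv\<^bsub>H\<^esub> y"
    using ext x y by (metis G.inv_closed extension_def extension_inv)
  have "x \<otimes>\<^bsub>G\<^esub> inv\<^bsub>G\<^esub> y \<in> carrier G" using x y by simp
  then show "val G (x \<otimes>\<^bsub>G\<^esub> inv\<^bsub>G\<^esub> y) = val H (x \<otimes>\<^bsub>H\<^esub> inv\<^bsub>H\<^esub> y)"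
    using ext 1 by (metis extension_def)
qed

text \<open>Immediacy, applied to the nonzero element b - g of \<open>K\<close>, gives x in
  \<open>G\<close> with b - g - x of larger value. The better approximation is g + x.\<close>

lemma immediate_extension_improve:
  assumes im: "immediate_extension G K" and ext: "extension K H"
    and b: "b \<in> carrier K" "b \<notin> carrier G" and g: "g \<in> carrier G"
  shows "\<exists>g'\<in>carrier G. val H (b \<otimes>\<^bsub>H\<^esub> inv\<^bsub>H\<^esub> g) < val H (b \<otimes>\<^bsub>H\<^esub> inv\<^bsub>H\<^esub> g')"
proof -
  have GK: "extension G K" using im by (simp add: immediate_extension_def)
  interpret G: valued_group G using GK by (simp add: extension_def)
  interpret K: valued_group K using GK by (simp add: extension_def)
  have sub: "x \<in> carrier K" if "x \<in> carrier G" for x using GK that by (auto simp: extension_def)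
  have "b \<otimes>\<^bsub>K\<^esub> inv\<^bsub>K\<^esub> g \<noteq> \<one>\<^bsub>K\<^esub>"
    using b g sub[OF g] by (metis K.inv_closed K.inv_equality K.inv_inv)
  then obtain x where x: "x \<in> carrier G"
    "val K (b \<otimes>\<^bsub>K\<^esub> inv\<^bsub>K\<^esub> g) < val K (b \<otimes>\<^bsub>K\<^esub> inv\<^bsub>K\<^esub> g \<otimes>\<^bsub>K\<^esub> inv\<^bsub>K\<^esub> x)"
    using im b(1) sub[OF g] unfolding immediate_extension_iff[OF GK]
    by (metis K.inv_closed K.m_closed)
  have "b \<otimes>\<^bsub>K\<^esub> inv\<^bsub>K\<^esub> g \<otimes>\<^bsub>K\<^esub> inv\<^bsub>K\<^esub> x = b \<otimes>\<^bsub>K\<^esub> inv\<^bsub>K\<^esub> (g \<otimes>\<^bsub>K\<^esub> x)"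
    using b(1) sub[OF g] sub[OF x(1)] by (simp add: K.inv_mult K.m_assoc)
  moreover have gx: "g \<otimes>\<^bsub>K\<^esub> x \<in> carrier G"
    using extension_subgroup[OF GK] g x(1) by (rule subgroup.m_closed)
  ultimately show ?thesis
    using x(2) extension_diff(2)[OF ext b(1)] sub[OF g] sub[OF gx] by metis
qed

section \<open>Subgroups of the integers\<close>

text \<open>Division with remainder by the least positive element; the trivial subgroup gives m =
  0.\<close>

lemma int_subgroup_multiples:
  fixes I :: "int set"
  assumes zero: "0 \<in> I" and diff: "\<And>k l. k \<in> I \<Longrightarrow> l \<in> I \<Longrightarrow> k - l \<in> I"
  obtains m where "m \<ge> 0" "I = {k. m dvd k}"
proof -
  have minus: "- k \<in> I" if "k \<in> I" for k using diff[OF zero that] by simp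
  have add: "k + l \<in> I" if "k \<in> I" "l \<in> I" for k l using diff[OF that(1) minus[OF that(2)]] by simp
  have nat_mult: "int n * k \<in> I" if "k \<in> I" for k n
  proof (induction n)
    case (Suc n)
    then show ?case using add[OF that Suc] by (simp add: distrib_right)
  qed (simp add: zero)
  have mult: "l * k \<in> I" if "k \<in> I" for k l
    using nat_mult[OF that, of "nat l"] minus[OF nat_mult[OF that, of "nat (- l)"]]
    by (cases "l \<ge> 0") simp_all
  show thesis
  proof (cases "I \<subseteq> {0}")
    case True
    then show ?thesis using zero by (intro that[of 0]) auto
  next
    case False
    then obtain k where k: "k \<in> I" "k \<noteq> 0" by blast
    define m where "m = (LEAST n::nat. n > 0 \<and> int n \<in> I)"
    have "nat \<bar>k\<bar> > 0 \<and> int (nat \<bar>k\<bar>) \<in> I" using k minus[OF k(1)] by (auto simp: abs_if)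
    then have m: "m > 0 \<and> int m \<in> I" unfolding m_def by (rule LeastI)
    have min: "\<not> (n > 0 \<and> int n \<in> I)" if "n < m" for n
      using that unfolding m_def by (rule not_less_Least)
    have "int m dvd l" if "l \<in> I" for l
    proof (rule ccontr)
      assume "\<not> int m dvd l"
      then have "l mod int m \<noteq> 0" by (simp add: dvd_eq_mod_eq_0)
      moreover have "0 \<le> l mod int m" "l mod int m < int m" using m by simp_all
      ultimately have "0 < nat (l mod int m)" "nat (l mod int m) < m" by linarith+
      moreover have "l mod int m \<in> I"
        using diff[OF that mult[of "int m" "l div int m"]] m by (simp add: minus_div_mult_eq_mod)
      ultimately show False using min[of "nat (l mod int m)"] by simp
    qed
    moreover have "l \<in> I" if "int m dvd l" for l
      using that mult[of "int m"] m by (metis dvd_def mult.commute)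
    ultimately show ?thesis by (intro that[of "int m"]) auto
  qed
qed

subsection \<open>Pseudo-Cauchy nets\<close>

text \<open>The filter of strict final segments. It turns conditions of the form "for some \<alpha>,
  for all i beyond \<alpha>" into eventual ones, which combine without choosing a common
  bound.\<close>

definition tail :: "'i rel \<Rightarrow> 'i filter" where
  "tail r = (INF b\<in>Field r. principal {i. (b, i) \<in> r - Id})"

lemma index_order_strict_trans:
  assumes "index_order r" "(i, j) \<in> r - Id" "(j, k) \<in> r - Id"
  shows "(i, k) \<in> r - Id"
proof -
  have "trans r" "antisym r" using assms(1) unfolding index_order_def order_on_defs by blast+
  then show ?thesis using assms(2,3) by (auto dest: transD antisymD)
qed

text \<open>Totality makes the final segments nested, so they form a filter base.\<close>

lemma eventually_tail:
  assumes r: "index_order r" and ne: "Field r \<noteq> {}"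
  shows "eventually P (tail r) \<longleftrightarrow> (\<exists>b\<in>Field r. \<forall>i. (b, i) \<in> r - Id \<longrightarrow> P i)"
proof -
  have "\<exists>x\<in>Field r. principal {i. (x, i) \<in> r - Id}
      \<le> inf (principal {i. (a, i) \<in> r - Id}) (principal {i. (b, i) \<in> r - Id})"
    if "a \<in> Field r" "b \<in> Field r" for a b
  proof -
    have "a = b \<or> (a, b) \<in> r - Id \<or> (b, a) \<in> r - Id"
      using r that unfolding index_order_def order_on_defs total_on_def by auto
    moreover have "{i. (y, i) \<in> r - Id} \<subseteq> {i. (x, i) \<in> r - Id}" if "(x, y) \<in> r - Id" for x y
      using index_order_strict_trans[OF r that] by blast
    ultimately show ?thesis using that by (simp add: le_principal eventually_principal) blast
  qed
  then show ?thesis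
    unfolding tail_def using ne by (subst eventually_INF_base) (auto simp: eventually_principal)
qed

lemma tail_nontrivial:
  assumes r: "index_order r" and ne: "Field r \<noteq> {}"
  shows "tail r \<noteq> bot"
  unfolding trivial_limit_def eventually_tail[OF assms] using r by (simp add: index_order_def)

section \<open>Limits of integer multiples of a net\<close>

text \<open>The gap \<open>c i\<close> stands for the common value of a_i - a_j for late j. Only a
  lower bound is assumed, because multiplication by an integer may raise values.\<close>

locale pseudo_cauchy_net = valued_group G
  for G :: "('a, 'v::{linorder,order_top}) vgroup" (structure) +
  fixes F :: "'i filter" and a :: "'i \<Rightarrow> 'a" and c :: "'i \<Rightarrow> 'v"
  assumes nontrivial: "F \<noteq> bot"
    and ev_carrier: "\<forall>\<^sub>F i in F. a i \<in> carrier G"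
    and ev_increasing: "\<forall>\<^sub>F i in F. \<forall>\<^sub>F j in F. c i < c j \<and> c i \<le> val G (a j \<otimes> inv (a i))"
begin

text \<open>Only \<open>\<le>\<close> is required here, so that the \<open>k\<close> admitting a limit are closed under subtraction.\<close>
definition multiple_limit :: "int \<Rightarrow> 'a \<Rightarrow> bool" where
  "multiple_limit k g \<longleftrightarrow> g \<in> carrier G \<and> (\<forall>\<^sub>F i in F. c i \<le> val G (a i [^] k \<otimes> inv g))"

text \<open>The net of multiples k a_i keeps the gaps \<open>c i\<close>, since val (k y) \<ge> val
  y.\<close>

lemma ev_increasing_pow:
  "\<forall>\<^sub>F i in F. \<forall>\<^sub>F j in F. c i < c j \<and> c i \<le> val G (a j [^] (k::int) \<otimes> inv (a i [^] k))"
  using ev_increasing ev_carrier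
proof eventually_elim
  case (elim i)
  show ?case using elim(1) ev_carrier
  proof eventually_elim
    case (elim j)
    then show ?case using \<open>a i \<in> carrier G\<close> val_int_pow_ge[of "a j \<otimes> inv (a i)" k]
      by (auto simp: int_pow_diff_distrib)
  qed
qed

text \<open>As -h is not a limit of k a_i, the value of h + k a_i lies below \<open>c i\<close> for
  some arbitrarily late i. Fix such an i: passing to a later j adds k (a_j - a_i), of value at least
  \<open>c i\<close>, which leaves the value unchanged.\<close>

lemma eventually_const:
  fixes k :: int
  assumes k: "\<And>g. \<not> multiple_limit k g" and h: "h \<in> carrier G"
  shows "\<exists>w. \<forall>\<^sub>F i in F. val G (h \<otimes> a i [^] k) = w \<and> w < c i"
proof -
  have "\<not> (\<forall>\<^sub>F i in F. c i \<le> val G (a i [^] k \<otimes> inv (inv h)))"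
    using k[of "inv h"] h by (simp add: multiple_limit_def)
  then have "\<exists>\<^sub>F i in F. val G (a i [^] k \<otimes> h) < c i"
    using h by (simp add: not_eventually not_le)
  then obtain i where i: "val G (a i [^] k \<otimes> h) < c i" "a i \<in> carrier G"
    "\<forall>\<^sub>F j in F. c i < c j \<and> c i \<le> val G (a j [^] k \<otimes> inv (a i [^] k))"
    using frequently_ex[OF frequently_eventually_frequently[OF _
      eventually_conj[OF ev_carrier ev_increasing_pow[of k]]]] by blast
  from i(3) ev_carrier
  have "\<forall>\<^sub>F j in F. val G (h \<otimes> a j [^] k) = val G (a i [^] k \<otimes> h) \<and> val G (a i [^] k \<otimes> h) < c j"
  proof eventually_elim
    case (elim j)
    have "h \<otimes> a j [^] k = (a i [^] k \<otimes> h) \<otimes> (a j [^] k \<otimes> inv (a i [^] k))"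
      using h i(2) elim(2) by (simp add: mult_diff_cancel)
    then show ?case
      using val_mult_eq[of "a i [^] k \<otimes> h" "a j [^] k \<otimes> inv (a i [^] k)"] h i elim by auto
  qed
  then show ?thesis by blast
qed

text \<open>Limits of k a_i and l a_i subtract to a limit of (k - l) a_i for the same bounds
  \<open>c i\<close>. The case m = 0 means that only k = 0 has a limit.\<close>

lemma multiple_limits_ideal: "\<exists>m\<ge>0. \<forall>k. (\<exists>g. multiple_limit k g) \<longleftrightarrow> m dvd k"
proof -
  define I where "I = {k. \<exists>g. multiple_limit k g}"
  have diff: "k - l \<in> I" if "k \<in> I" "l \<in> I" for k l
  proof -
    obtain g h where "multiple_limit k g" "multiple_limit l h" using \<open>k \<in> I\<close> \<open>l \<in> I\<close> by (auto simp: I_def)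
    then have g: "g \<in> carrier G" "\<forall>\<^sub>F i in F. c i \<le> val G (a i [^] k \<otimes> inv g)"
      and h: "h \<in> carrier G" "\<forall>\<^sub>F i in F. c i \<le> val G (a i [^] l \<otimes> inv h)"
      by (simp_all only: multiple_limit_def)
    from g(2) h(2) ev_carrier have "\<forall>\<^sub>F i in F. c i \<le> val G (a i [^] (k - l) \<otimes> inv (g \<otimes> inv h))"
    proof eventually_elim
      case (elim i)
      have "a i [^] (k - l) \<otimes> inv (g \<otimes> inv h) = (a i [^] k \<otimes> inv g) \<otimes> inv (a i [^] l \<otimes> inv h)"
        using g(1) h(1) elim(3) by (simp add: int_pow_diff diff_diff_swap)
      then show ?case
        using val_diff[of "a i [^] k \<otimes> inv g" "a i [^] l \<otimes> inv h"] g(1) h(1) elim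
        by (auto simp: min_le_iff_disj)
    qed
    then have "multiple_limit (k - l) (g \<otimes> inv h)" using g(1) h(1) by (simp add: multiple_limit_def)
    then show ?thesis by (auto simp: I_def)
  qed
  have "multiple_limit 0 \<one>" by (simp add: multiple_limit_def val_one)
  then have zero: "0 \<in> I" by (auto simp: I_def)
  obtain m where m: "m \<ge> 0" "I = {k. m dvd k}" using int_subgroup_multiples[OF zero diff] .
  then have "(\<exists>g. multiple_limit k g) \<longleftrightarrow> m dvd k" for k unfolding I_def by (simp add: set_eq_iff)
  with m(1) show ?thesis by blast
qed

lemma multiple_limit_1:
  assumes "multiple_limit 1 x"
  shows "x \<in> carrier G" "\<forall>\<^sub>F i in F. c i \<le> val G (a i \<otimes> inv x)"
proof -
  have x: "x \<in> carrier G" and 1: "\<forall>\<^sub>F i in F. c i \<le> val G (a i [^] (1::int) \<otimes> inv x)"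
    using assms by (simp_all only: multiple_limit_def)
  show "x \<in> carrier G" by (rule x)
  from 1 ev_carrier show "\<forall>\<^sub>F i in F. c i \<le> val G (a i \<otimes> inv x)"
    by eventually_elim simp
qed

text \<open>
  A best approximation of \<open>g\<close> by multiples \<open>n g'\<close> is at least as close to \<open>g\<close> as each \<open>n a\<^sub>i\<close>, and
  dividing by \<open>n\<close> preserves the values.
\<close>
lemma multiple_limit_divide:
  assumes Z: "Z_invariant G" and n: "n > 0" and lim: "multiple_limit (int n) g"
    and max: "has_maximum (Delta G n g)"
  shows "\<exists>g'. multiple_limit 1 g'"
proof -
  have g: "g \<in> carrier G" and ev: "\<forall>\<^sub>F i in F. c i \<le> val G (a i [^] int n \<otimes> inv g)"
    using lim by (simp_all only: multiple_limit_def)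
  obtain g' where g': "g' \<in> carrier G"
    and best: "\<And>h. h \<in> carrier G \<Longrightarrow> val G (g \<otimes> inv (h [^] n)) \<le> val G (g \<otimes> inv (g' [^] n))"
    using max unfolding has_maximum_def Delta_def by blast
  from ev ev_carrier have "\<forall>\<^sub>F i in F. c i \<le> val G (a i [^] (1::int) \<otimes> inv g')"
  proof eventually_elim
    case (elim i)
    have "val G (a i \<otimes> inv g') = val G ((a i \<otimes> inv g') [^] int n)"
      using Z n g' elim(2) by (simp add: Z_invariant_def)
    also have "(a i \<otimes> inv g') [^] int n = (a i [^] int n \<otimes> inv g) \<otimes> (g \<otimes> inv (g' [^] int n))"
      using g g' elim(2) by (simp only: int_pow_diff_distrib diff_add_diff int_pow_closed)
    finally have eq: "val G (a i \<otimes> inv g') = val G ((a i [^] int n \<otimes> inv g) \<otimes> (g \<otimes> inv (g' [^] int n)))" .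
    have "c i \<le> val G (g \<otimes> inv (a i [^] int n))"
      using elim g by (simp only: val_minus_commute int_pow_closed)
    also have "\<dots> \<le> val G (g \<otimes> inv (g' [^] int n))"
      using best[OF elim(2)] by (simp only: int_pow_int)
    finally have "c i \<le> min (val G (a i [^] int n \<otimes> inv g)) (val G (g \<otimes> inv (g' [^] int n)))"
      using elim(1) by simp
    also have "\<dots> \<le> val G (a i \<otimes> inv g')"
      unfolding eq using g g' elim(2) by (intro val_mult m_closed inv_closed int_pow_closed)
    finally show ?case using elim(2) by simp
  qed
  then show ?thesis using g' by (auto simp: multiple_limit_def)
qed

text \<open>Passing from k to the generator m makes the multiplier positive, so that
  \<open>multiple_limit_divide\<close> yields a limit of the net itself.\<close>

lemma no_multiple_limit:
  assumes Z: "Z_invariant G" and max: "\<And>g n. g \<in> carrier G \<Longrightarrow> has_maximum (Delta G n g)"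
    and no_limit: "\<And>g. \<not> multiple_limit 1 g" and k: "k \<noteq> 0"
  shows "\<not> multiple_limit k g"
proof
  assume lim: "multiple_limit k g"
  obtain m where m: "m \<ge> 0" "\<And>k. (\<exists>g. multiple_limit k g) \<longleftrightarrow> m dvd k"
    using multiple_limits_ideal by blast
  have "m dvd k" using m(2) lim by blast
  then have "m > 0" using m(1) k by (cases "m = 0") auto
  moreover obtain h where "multiple_limit m h" using m(2)[of m] by auto
  moreover from this have "h \<in> carrier G" by (simp add: multiple_limit_def)
  ultimately show False
    using multiple_limit_divide[OF Z, of "nat m" h] max no_limit by auto
qed

text \<open>The group G + \<int> b is a proper immediate extension. For x = h + k b with k \<noteq>
  0, the element g = h + k a_i of \<open>G\<close> has value w < \<open>c i\<close> for late i,
  while x - g = k (b - a_i) has value at least \<open>c i\<close>; hence val x = w < val (x -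
  g).\<close>

lemma adjoin_limit:
  assumes ext: "extension G H" and b: "b \<in> carrier H"
    and lim: "\<forall>\<^sub>F i in F. c i \<le> val H (a i \<otimes>\<^bsub>H\<^esub> inv\<^bsub>H\<^esub> b)"
    and no_limit: "\<And>k g. k \<noteq> 0 \<Longrightarrow> \<not> multiple_limit k g"
  shows "\<not> maximal_in G H"
proof -
  interpret H: valued_group H using ext by (simp add: extension_def)
  have GH: "x \<in> carrier H" "val G x = val H x" if "x \<in> carrier G" for x
    using that ext by (auto simp: extension_def)
  have mGH: "x \<otimes> y = x \<otimes>\<^bsub>H\<^esub> y" if "x \<in> carrier G" "y \<in> carrier G" for x y
    using that ext by (auto simp: extension_def)
  note powGH = extension_int_pow[OF ext]
  \<comment> \<open>Written as a sum of two subgroups, G + \<int> b is a subgroup by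
    \<open>mult_subgroups\<close>.\<close>
  define C where "C = carrier G <#>\<^bsub>H\<^esub> generate H {b}"
  define K where "K = H\<lparr>carrier := C\<rparr>"
  have C: "x \<in> C \<longleftrightarrow> (\<exists>h\<in>carrier G. \<exists>k::int. x = h \<otimes>\<^bsub>H\<^esub> b [^]\<^bsub>H\<^esub> k)" for x
    by (auto simp: C_def set_mult_def H.generate_pow[OF b])
  have "subgroup C H"
    unfolding C_def using b
    by (intro H.mult_subgroups extension_subgroup[OF ext] H.generate_is_subgroup) simp
  then have KH: "extension K H" unfolding K_def by (rule H.valued_subgroup)
  have selK: "carrier K = C" "x \<otimes>\<^bsub>K\<^esub> y = x \<otimes>\<^bsub>H\<^esub> y" "val K x = val H x" "\<one>\<^bsub>K\<^esub> = \<one>\<^bsub>H\<^esub>" for x y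
    by (simp_all add: K_def)
  have GC: "x \<in> C" if "x \<in> carrier G" for x
    unfolding C using that GH b by (intro bexI[of _ x] exI[of _ 0]) simp_all
  have GK: "extension G K"
    using ext KH GC by (auto simp: extension_def selK)
  have bC: "b \<in> C"
    unfolding C using b one_closed by (intro bexI[of _ \<one>] exI[of _ 1]) (simp_all add: extension_one[OF ext])
  have "b \<notin> carrier G"
  proof
    assume bG: "b \<in> carrier G"
    \<comment> \<open>If b were in \<open>G\<close>, it would be a limit for the multiplier
      1.\<close>
    from lim ev_carrier have "\<forall>\<^sub>F i in F. c i \<le> val G (a i [^] (1::int) \<otimes> inv b)"
      by eventually_elim (simp add: extension_diff(2)[OF ext _ bG])
    then show False using no_limit[of 1 b] bG by (simp add: multiple_limit_def)
  qed
  moreover have "immediate_extension G K"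
    unfolding immediate_extension_iff[OF GK]
  proof (intro ballI impI)
    fix x assume x: "x \<in> carrier K" "x \<noteq> \<one>\<^bsub>K\<^esub>"
    then obtain h and k :: int where h: "h \<in> carrier G" and xhk: "x = h \<otimes>\<^bsub>H\<^esub> b [^]\<^bsub>H\<^esub> k"
      using C selK(1) by blast
    have xH: "x \<in> carrier H" using xhk GH(1)[OF h] b by simp
    have "\<exists>g\<in>carrier G. val H x < val H (x \<otimes>\<^bsub>H\<^esub> inv\<^bsub>H\<^esub> g)"
    proof (cases "k = 0")
      case True
      then have "x = h" using xhk GH(1)[OF h] by simp
      then have "val H (x \<otimes>\<^bsub>H\<^esub> inv\<^bsub>H\<^esub> h) = top_class.top" using xH by (simp add: H.val_one)
      moreover have "val H x < top_class.top"
        using x(2) xH H.val_eq_top[of x] by (simp add: selK(4) less_top)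
      ultimately show ?thesis using h by (intro bexI[of _ h]) simp_all
    next
      case False
      obtain w where w: "\<forall>\<^sub>F i in F. val G (h \<otimes> a i [^] k) = w \<and> w < c i"
        using eventually_const[OF no_limit[OF False] h] by blast
      obtain i where i: "val G (h \<otimes> a i [^] k) = w" "w < c i" "a i \<in> carrier G"
          "c i \<le> val H (a i \<otimes>\<^bsub>H\<^esub> inv\<^bsub>H\<^esub> b)"
        using eventually_happens'[OF nontrivial eventually_conj[OF w eventually_conj[OF ev_carrier lim]]]
        by blast
      define g where "g = h \<otimes>\<^bsub>H\<^esub> a i [^]\<^bsub>H\<^esub> k"
      have gG: "g = h \<otimes> a i [^] k"
        using mGH[OF h int_pow_closed[OF i(3), of k]] powGH[OF i(3)] by (simp add: g_def)
      then have g: "g \<in> carrier G" "g \<in> carrier H" using h i(3) GH(1) by auto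
      have aH: "a i \<in> carrier H" "h \<in> carrier H" using i(3) h GH by auto
      have "x \<otimes>\<^bsub>H\<^esub> inv\<^bsub>H\<^esub> g = (b \<otimes>\<^bsub>H\<^esub> inv\<^bsub>H\<^esub> a i) [^]\<^bsub>H\<^esub> k"
        unfolding xhk g_def using H.mult_diff_cancel[of h "b [^]\<^bsub>H\<^esub> k" "inv\<^bsub>H\<^esub> (a i [^]\<^bsub>H\<^esub> k)"] aH b
        by (simp add: H.inv_mult H.int_pow_diff_distrib H.m_comm[of "inv\<^bsub>H\<^esub> h"])
      moreover have "c i \<le> val H ((b \<otimes>\<^bsub>H\<^esub> inv\<^bsub>H\<^esub> a i) [^]\<^bsub>H\<^esub> k)"
        using i(4) H.val_int_pow_ge[of "b \<otimes>\<^bsub>H\<^esub> inv\<^bsub>H\<^esub> a i" k] H.val_minus_commute[OF b aH(1)] aH b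
        by auto
      ultimately have less: "w < val H (x \<otimes>\<^bsub>H\<^esub> inv\<^bsub>H\<^esub> g)" using i(2) by auto
      have wg: "val H g = w" using i(1) GH(2)[OF g(1)] gG by simp
      have "val H x = w"
      proof -
        have "val H (g \<otimes>\<^bsub>H\<^esub> (x \<otimes>\<^bsub>H\<^esub> inv\<^bsub>H\<^esub> g)) = w"
          using H.val_mult_eq[of g "x \<otimes>\<^bsub>H\<^esub> inv\<^bsub>H\<^esub> g"] wg less g(2) xH by simp
        moreover have "g \<otimes>\<^bsub>H\<^esub> (x \<otimes>\<^bsub>H\<^esub> inv\<^bsub>H\<^esub> g) = x"
          using H.mult_diff_cancel[of g "\<one>\<^bsub>H\<^esub>" x] g(2) xH by simp
        ultimately show ?thesis by simp
      qed
      then show ?thesis using less g(1) by blast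
    qed
    then obtain g where "g \<in> carrier G" "val H x < val H (x \<otimes>\<^bsub>H\<^esub> inv\<^bsub>H\<^esub> g)" by blast
    then show "\<exists>g\<in>carrier G. val K x < val K (x \<otimes>\<^bsub>K\<^esub> inv\<^bsub>K\<^esub> g)"
      using GC extension_inv[OF KH] by (intro bexI[of _ g]) (simp_all add: selK)
  qed
  moreover have "carrier G \<subseteq> carrier K" "b \<in> carrier K" using GC bC selK(1) by auto
  ultimately show ?thesis using KH unfolding maximal_in_def by blast
qed

end

section \<open>From pseudo-Cauchy sequences to nets\<close>

text \<open>The last two conclusions translate between pseudo-limits and the weak bound by
  \<open>c i\<close>. The bound recovers the required equality because \<open>c\<close> increases
  strictly.\<close>

lemma (in valued_group) pseudo_cauchy_net_tail:
  fixes r :: "'i rel"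
  assumes pc: "pseudo_cauchy G r a"
  obtains c where "pseudo_cauchy_net G (tail r) a c"
    and "\<And>x. \<lbrakk>x \<in> carrier G; \<forall>\<^sub>F i in tail r. c i \<le> val G (a i \<otimes> inv x)\<rbrakk> \<Longrightarrow> pseudo_limit G r a x"
    and "\<And>H b. \<lbrakk>extension G H; pseudo_limit H r a b\<rbrakk>
      \<Longrightarrow> \<forall>\<^sub>F i in tail r. c i \<le> val H (a i \<otimes>\<^bsub>H\<^esub> inv\<^bsub>H\<^esub> b)"
proof -
  have r: "index_order r" and carr: "\<And>i. i \<in> Field r \<Longrightarrow> a i \<in> carrier G"
    using pc by (auto simp: pseudo_cauchy_def)
  obtain \<alpha> where \<alpha>: "\<alpha> \<in> Field r" and inc:
    "\<And>i j k. \<lbrakk>(\<alpha>, i) \<in> r - Id; (i, j) \<in> r - Id; (j, k) \<in> r - Id\<rbrakk>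
      \<Longrightarrow> val G (a i \<otimes> inv (a j)) < val G (a j \<otimes> inv (a k))"
    using pc unfolding pseudo_cauchy_def by blast
  have ne: "Field r \<noteq> {}" using \<alpha> by blast
  note ev = eventually_tail[OF r ne]
  have F: "i \<in> Field r" "j \<in> Field r" if "(i, j) \<in> r - Id" for i j
    using that by (auto simp: Field_def)
  \<comment> \<open>Any larger index will do: beyond \<alpha> the value of a_i - a_j does not depend
    on j > i.\<close>
  define s where "s i = (SOME j. (i, j) \<in> r - Id)" for i
  have s: "(i, s i) \<in> r - Id" if "i \<in> Field r" for i
    unfolding s_def by (rule someI_ex) (use r that in \<open>simp add: index_order_def\<close>)
  define c where "c i = val G (a i \<otimes> inv (a (s i)))" for i
  have step: "val G (a i \<otimes> inv (a k)) = val G (a i \<otimes> inv (a j))"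
    if "(\<alpha>, i) \<in> r - Id" "(i, j) \<in> r - Id" "(j, k) \<in> r - Id" for i j k
  proof -
    have "a i \<in> carrier G" "a j \<in> carrier G" "a k \<in> carrier G" using carr F that by blast+
    then show ?thesis
      using val_mult_eq[of "a i \<otimes> inv (a j)" "a j \<otimes> inv (a k)"] inc[OF that]
      by (simp add: diff_add_diff)
  qed
  have c: "val G (a i \<otimes> inv (a j)) = c i" if "(\<alpha>, i) \<in> r - Id" "(i, j) \<in> r - Id" for i j
  proof -
    have si: "(i, s i) \<in> r - Id" using s F that by blast
    \<comment> \<open>\<open>step\<close> compares two later indices only in increasing order, hence
      the case distinction.\<close>
    have "j = s i \<or> (j, s i) \<in> r - Id \<or> (s i, j) \<in> r - Id"
      using r F[OF si] F[OF that(2)] unfolding index_order_def order_on_defs total_on_def by auto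
    then show ?thesis using step[OF that, of "s i"] step[OF that(1) si, of j] by (auto simp: c_def)
  qed
  have c_less: "c i < c j" if "(\<alpha>, i) \<in> r - Id" "(i, j) \<in> r - Id" for i j
    using inc[OF that s] F[OF that(2)] c[OF that] by (simp add: c_def)
  have above: "\<forall>\<^sub>F i in tail r. (i0, i) \<in> r - Id" if "i0 \<in> Field r" for i0
    unfolding ev using that by blast
  show thesis
  proof (rule that)
    show "pseudo_cauchy_net G (tail r) a c"
    proof
      show "tail r \<noteq> bot" by (rule tail_nontrivial[OF r ne])
      show "\<forall>\<^sub>F i in tail r. a i \<in> carrier G"
        using above[OF \<alpha>] by eventually_elim (use carr F in blast)
      show "\<forall>\<^sub>F i in tail r. \<forall>\<^sub>F j in tail r. c i < c j \<and> c i \<le> val G (a j \<otimes> inv (a i))"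
        using above[OF \<alpha>]
      proof eventually_elim
        case (elim i)
        show ?case using above[OF F(2)[OF elim]]
        proof eventually_elim
          case (elim j)
          then show ?case
            using c_less[OF \<open>(\<alpha>, i) \<in> r - Id\<close> elim] c[OF \<open>(\<alpha>, i) \<in> r - Id\<close> elim]
              val_minus_commute[of "a i" "a j"] carr F[OF elim] by simp
        qed
      qed
    qed
  next
    fix x assume x: "x \<in> carrier G" "\<forall>\<^sub>F i in tail r. c i \<le> val G (a i \<otimes> inv x)"
    obtain \<beta> where \<beta>: "\<beta> \<in> Field r" and le: "\<And>i. (\<beta>, i) \<in> r - Id \<Longrightarrow> c i \<le> val G (a i \<otimes> inv x)"
      and \<alpha>\<beta>: "\<And>i. (\<beta>, i) \<in> r - Id \<Longrightarrow> (\<alpha>, i) \<in> r - Id"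
      using eventually_conj[OF x(2) above[OF \<alpha>]] unfolding ev by blast
    show "pseudo_limit G r a x"
      unfolding pseudo_limit_def
    proof (intro conjI bexI[of _ \<beta>] allI impI x(1) \<beta>)
      fix i j assume "(\<beta>, i) \<in> r - Id \<and> (i, j) \<in> r - Id"
      then have \<beta>i: "(\<beta>, i) \<in> r - Id" and ij: "(i, j) \<in> r - Id" by blast+
      have \<beta>j: "(\<beta>, j) \<in> r - Id" using index_order_strict_trans[OF r \<beta>i ij] .
      have aG: "a i \<in> carrier G" "a j \<in> carrier G" using carr F[OF ij] by blast+
      \<comment> \<open>Going through a later a_j gives strictness: a_j - x has value at least
        \<open>c j\<close> > \<open>c i\<close>.\<close>
      have "val G (a i \<otimes> inv (a j)) < val G (a j \<otimes> inv x)"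
        using c[OF \<alpha>\<beta>[OF \<beta>i] ij] c_less[OF \<alpha>\<beta>[OF \<beta>i] ij] le[OF \<beta>j] by simp
      then show "val G (a i \<otimes> inv x) = val G (a i \<otimes> inv (a j))"
        using val_mult_eq[of "a i \<otimes> inv (a j)" "a j \<otimes> inv x"] aG x(1) by (simp add: diff_add_diff)
    qed
  next
    fix H b assume ext: "extension G H" and b: "pseudo_limit H r a b"
    obtain \<beta> where \<beta>: "\<beta> \<in> Field r" and eq: "\<And>i j. \<lbrakk>(\<beta>, i) \<in> r - Id; (i, j) \<in> r - Id\<rbrakk>
        \<Longrightarrow> val H (a i \<otimes>\<^bsub>H\<^esub> inv\<^bsub>H\<^esub> b) = val H (a i \<otimes>\<^bsub>H\<^esub> inv\<^bsub>H\<^esub> (a j))"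
      using b unfolding pseudo_limit_def by blast
    show "\<forall>\<^sub>F i in tail r. c i \<le> val H (a i \<otimes>\<^bsub>H\<^esub> inv\<^bsub>H\<^esub> b)"
      using above[OF \<beta>]
    proof eventually_elim
      case (elim i)
      have si: "(i, s i) \<in> r - Id" by (rule s[OF F(2)[OF elim]])
      then show ?case
        using eq[OF elim si] extension_diff(2)[OF ext carr carr, of i "s i"] F[OF si]
        by (simp add: c_def)
    qed
  qed
qed

section \<open>Relative maximality implies relative pseudo-completeness\<close>

text \<open>A sequence with a pseudo-limit b in \<open>H\<close> but none in \<open>G\<close> would
  make G + \<int> b a proper immediate extension of \<open>G\<close> inside
  \<open>H\<close>.\<close>

lemma maximal_in_imp_pseudo_complete_in:
  assumes Z: "Z_invariant G" and max: "\<And>g n. g \<in> carrier G \<Longrightarrow> has_maximum (Delta G n g)"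
    and ext: "extension G H" and maximal: "maximal_in G H"
  shows "pseudo_complete_in G H"
  unfolding pseudo_complete_in_def
proof (intro allI impI, elim conjE exE, rule ccontr)
  interpret G: valued_group G using ext by (simp add: extension_def)
  fix r :: "'a rel" and a b
  assume pc: "pseudo_cauchy G r a" and b: "pseudo_limit H r a b" and no: "\<not> (\<exists>x. pseudo_limit G r a x)"
  obtain c where net: "pseudo_cauchy_net G (tail r) a c"
    and lim: "\<And>x. \<lbrakk>x \<in> carrier G; \<forall>\<^sub>F i in tail r. c i \<le> val G (a i \<otimes>\<^bsub>G\<^esub> inv\<^bsub>G\<^esub> x)\<rbrakk>
      \<Longrightarrow> pseudo_limit G r a x"
    and limH: "\<And>H b. \<lbrakk>extension G H; pseudo_limit H r a b\<rbrakk>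
      \<Longrightarrow> \<forall>\<^sub>F i in tail r. c i \<le> val H (a i \<otimes>\<^bsub>H\<^esub> inv\<^bsub>H\<^esub> b)"
    using G.pseudo_cauchy_net_tail[OF pc] by blast
  interpret pseudo_cauchy_net G "tail r" a c by (rule net)
  have "\<not> multiple_limit 1 x" for x using multiple_limit_1 lim no by blast
  moreover have "b \<in> carrier H" using b by (simp add: pseudo_limit_def)
  ultimately show False
    using adjoin_limit[OF ext _ limH[OF ext b]] no_multiple_limit[OF Z max] maximal by blast
qed

subsection \<open>Pseudo-completeness implies maximality\<close>

text \<open>
  A cofinal pseudo-Cauchy sequence of approximations to \<open>b\<close> consists of the records of
  \<open>g \<mapsto> val (b - g)\<close> along an arbitrary well-order of the carrier.
\<close>
lemma approximable_imp_not_pseudo_complete_in: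
  fixes G :: "('a, 'v::{linorder,order_top}) vgroup"
  assumes ext: "extension G H" and b: "b \<in> carrier H"
    and improve: "\<And>g. g \<in> carrier G \<Longrightarrow>
      \<exists>g'\<in>carrier G. val H (b \<otimes>\<^bsub>H\<^esub> inv\<^bsub>H\<^esub> g) < val H (b \<otimes>\<^bsub>H\<^esub> inv\<^bsub>H\<^esub> g')"
  shows "\<not> pseudo_complete_in G H"
proof
  assume complete: "pseudo_complete_in G H"
  interpret G: valued_group G using ext by (simp add: extension_def)
  interpret H: valued_group H using ext by (simp add: extension_def)
  have GH: "x \<in> carrier H" if "x \<in> carrier G" for x using that ext by (auto simp: extension_def)
  define d where "d g = val H (b \<otimes>\<^bsub>H\<^esub> inv\<^bsub>H\<^esub> g)" for g
  obtain w :: "'a rel" where "well_order_on UNIV w" using well_order_on by blast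
  then have w: "Well_order w" and Fw: "Field w = UNIV"
    using well_order_on_Well_order by blast+
  define S where "S = {g \<in> carrier G. \<forall>g'\<in>carrier G. (g', g) \<in> w - Id \<longrightarrow> d g' < d g}"
  define r where "r = Restr w S"
  have SG: "g \<in> carrier G" if "g \<in> S" for g using that by (simp add: S_def)
  have wf: "wf (w - Id)" using w by (simp add: well_order_on_def)
  have tot: "(x, y) \<in> w \<or> (y, x) \<in> w" for x y
    using w Fw unfolding order_on_defs total_on_def refl_on_def by (cases "x = y") auto
  \<comment> \<open>The \<open>w\<close>-least h with d g \<le> d h is a record: every earlier
    element of \<open>G\<close> has d-value below d g.\<close>
  have cofinal: "\<exists>s\<in>S. d g \<le> d s" if g: "g \<in> carrier G" for g
  proof -
    obtain s where s: "s \<in> {h \<in> carrier G. d g \<le> d h}"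
      and min: "\<And>y. (y, s) \<in> w - Id \<Longrightarrow> y \<notin> {h \<in> carrier G. d g \<le> d h}"
      using wfE_min[OF wf, of g "{h \<in> carrier G. d g \<le> d h}"] g by blast
    have "s \<in> S" unfolding S_def using s min by fastforce
    then show ?thesis using s by blast
  qed
  have Fr: "Field r = S"
    unfolding r_def using w Fw by (subst Refl_Field_Restr) (auto simp: order_on_defs)
  have rD: "i \<in> S" "j \<in> S" "d i < d j" if "(i, j) \<in> r - Id" for i j
    using that unfolding r_def by (auto simp: S_def)
  \<comment> \<open>Since \<open>d\<close> increases strictly along the records, their order under
    \<open>w\<close> is their order by closeness to b.\<close>
  have rI: "(i, j) \<in> r - Id" if "i \<in> S" "j \<in> S" "d i < d j" for i j
    using tot[of i j] that rD[of j i] unfolding r_def by fastforce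
  have larger: "\<exists>s\<in>S. d g < d s" if "g \<in> carrier G" for g
    using improve[OF that] cofinal unfolding d_def by (meson less_le_trans)
  have idx: "index_order r"
    unfolding index_order_def
  proof (intro conjI ballI)
    show "Well_order r" unfolding r_def by (rule Well_order_Restr[OF w])
    show "\<exists>j. (i, j) \<in> r - Id" if "i \<in> Field r" for i
      using that larger[OF SG] rI unfolding Fr by blast
  qed
  have val_b: "val H (i \<otimes>\<^bsub>H\<^esub> inv\<^bsub>H\<^esub> b) = d i" if "i \<in> S" for i
    using H.val_minus_commute[of b i] GH[OF SG[OF that]] b by (simp add: d_def)
  \<comment> \<open>In i - j = (i - b) + (b - j) the second summand has the larger value.\<close>
  have val_d: "val H (i \<otimes>\<^bsub>H\<^esub> inv\<^bsub>H\<^esub> j) = d i" if "(i, j) \<in> r - Id" for i j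
  proof -
    have "i \<in> carrier H" "j \<in> carrier H" using rD[OF that] SG GH by blast+
    then show ?thesis
      using H.val_mult_eq[of "i \<otimes>\<^bsub>H\<^esub> inv\<^bsub>H\<^esub> b" "b \<otimes>\<^bsub>H\<^esub> inv\<^bsub>H\<^esub> j"] val_b[of i] rD[OF that] b
      by (simp add: H.diff_add_diff d_def)
  qed
  have val_dG: "val G (i \<otimes>\<^bsub>G\<^esub> inv\<^bsub>G\<^esub> j) = d i" if "(i, j) \<in> r - Id" for i j
    using val_d[OF that] extension_diff(2)[OF ext SG SG] rD[OF that] by simp
  obtain \<alpha> where \<alpha>: "\<alpha> \<in> S" using cofinal[OF G.one_closed] by blast
  have "pseudo_cauchy G r id"
    unfolding pseudo_cauchy_def Fr
  proof (intro conjI ballI bexI[of _ \<alpha>] allI impI idx \<alpha>)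
    show "id i \<in> carrier G" if "i \<in> S" for i using SG[OF that] by simp
    fix i j k assume "(\<alpha>, i) \<in> r - Id \<and> (i, j) \<in> r - Id \<and> (j, k) \<in> r - Id"
    then have ij: "(i, j) \<in> r - Id" and jk: "(j, k) \<in> r - Id" by blast+
    show "val G (id i \<otimes>\<^bsub>G\<^esub> inv\<^bsub>G\<^esub> (id j)) < val G (id j \<otimes>\<^bsub>G\<^esub> inv\<^bsub>G\<^esub> (id k))"
      using val_dG[OF ij] val_dG[OF jk] rD(3)[OF ij] by simp
  qed
  moreover have "pseudo_limit H r id b"
    unfolding pseudo_limit_def Fr
  proof (intro conjI bexI[of _ \<alpha>] allI impI b \<alpha>)
    fix i j assume "(\<alpha>, i) \<in> r - Id \<and> (i, j) \<in> r - Id"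
    then have "(i, j) \<in> r - Id" by blast
    then show "val H (id i \<otimes>\<^bsub>H\<^esub> inv\<^bsub>H\<^esub> b) = val H (id i \<otimes>\<^bsub>H\<^esub> inv\<^bsub>H\<^esub> (id j))"
      using val_d val_b rD(1) by simp
  qed
  ultimately obtain x where "pseudo_limit G r id x"
    using complete unfolding pseudo_complete_in_def by blast
  then obtain \<beta> where x: "x \<in> carrier G" and \<beta>: "\<beta> \<in> S"
    and eq: "\<And>i j. \<lbrakk>(\<beta>, i) \<in> r - Id; (i, j) \<in> r - Id\<rbrakk>
      \<Longrightarrow> val G (i \<otimes>\<^bsub>G\<^esub> inv\<^bsub>G\<^esub> x) = val G (i \<otimes>\<^bsub>G\<^esub> inv\<^bsub>G\<^esub> j)"
    unfolding pseudo_limit_def Fr by auto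
  obtain s where s: "s \<in> S" "d x < d s" using larger[OF x] by blast
  \<comment> \<open>With \<open>t\<close> the closer to b of \<open>s\<close> and \<beta>, a record
    i beyond \<open>t\<close> lies beyond \<beta> and is closer to b than x is.\<close>
  define t where "t = (if d s \<le> d \<beta> then \<beta> else s)"
  have t: "t \<in> S" "d x < d t" "d \<beta> \<le> d t" using s \<beta> by (auto simp: t_def)
  obtain i where i: "i \<in> S" "d t < d i" using larger[OF SG[OF t(1)]] by blast
  obtain j where j: "j \<in> S" "d i < d j" using larger[OF SG[OF i(1)]] by blast
  have ij: "(i, j) \<in> r - Id" using rI i(1) j by blast
  have "(\<beta>, i) \<in> r - Id" using rI[OF \<beta> i(1)] t(3) i(2) by simp
  then have "val G (i \<otimes>\<^bsub>G\<^esub> inv\<^bsub>G\<^esub> x) = d i" using eq ij val_dG by metis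
  then have "val H (i \<otimes>\<^bsub>H\<^esub> inv\<^bsub>H\<^esub> x) = d i" using extension_diff(2)[OF ext SG[OF i(1)] x] by simp
  \<comment> \<open>b - x is the sum of b - i and i - x, both of value d i.\<close>
  then have "d i \<le> d x"
    using H.val_mult[of "b \<otimes>\<^bsub>H\<^esub> inv\<^bsub>H\<^esub> i" "i \<otimes>\<^bsub>H\<^esub> inv\<^bsub>H\<^esub> x"] b GH[OF SG[OF i(1)]] GH[OF x]
    by (simp add: H.diff_add_diff d_def del: min_le_iff_disj)
  then show False using t(2) i(2) by simp
qed

lemma pseudo_complete_in_imp_maximal_in:
  assumes ext: "extension G H" and complete: "pseudo_complete_in G H"
  shows "maximal_in G H"
  unfolding maximal_in_def
proof (intro notI, elim exE conjE)
  fix K assume im: "immediate_extension G K" and KH: "extension K H" and sub: "carrier G \<subset> carrier K"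
  obtain b where b: "b \<in> carrier K" "b \<notin> carrier G" using sub by blast
  have "b \<in> carrier H" using b(1) KH by (auto simp: extension_def)
  then show False
    using approximable_imp_not_pseudo_complete_in[OF ext _ immediate_extension_improve[OF im KH b]] complete
    by blast
qed

section \<open>Passing to isomorphic copies\<close>

text \<open>Needed because \<open>maximal\<close> speaks of copies of \<open>G\<close> on another
  type. A sequence is pulled back along \<open>f\<close> and its pseudo-limit is pushed
  forward.\<close>

lemma pseudo_complete_val_iso:
  fixes G :: "('a, 'v::{linorder,order_top}) vgroup" and G' :: "('b, 'v) vgroup"
  assumes G: "valued_group G" and G': "valued_group G'" and f: "f \<in> val_iso G G'"
    and complete: "pseudo_complete G"
  shows "pseudo_complete G'"
  unfolding pseudo_complete_def
proof (intro allI impI)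
  interpret G: valued_group G by fact
  interpret G': valued_group G' by fact
  fix r :: "'b rel" and a assume pc: "pseudo_cauchy G' r a"
  interpret f: group_hom G G' f
    using f by unfold_locales (simp add: val_iso_def iso_def)
  have diff: "val G' (f x \<otimes>\<^bsub>G'\<^esub> inv\<^bsub>G'\<^esub> (f y)) = val G (x \<otimes>\<^bsub>G\<^esub> inv\<^bsub>G\<^esub> y)"
    if "x \<in> carrier G" "y \<in> carrier G" for x y
  proof -
    have "f x \<otimes>\<^bsub>G'\<^esub> inv\<^bsub>G'\<^esub> (f y) = f (x \<otimes>\<^bsub>G\<^esub> inv\<^bsub>G\<^esub> y)" using that by simp
    moreover have "x \<otimes>\<^bsub>G\<^esub> inv\<^bsub>G\<^esub> y \<in> carrier G" using that by simp
    ultimately show ?thesis using f by (simp add: val_iso_def)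
  qed
  have im: "f ` carrier G = carrier G'" using f by (simp add: val_iso_def iso_def bij_betw_def)
  define a' where "a' i = inv_into (carrier G) f (a i)" for i
  have a: "a i \<in> carrier G'" if "i \<in> Field r" for i using pc that by (simp add: pseudo_cauchy_def)
  have a': "a' i \<in> carrier G" "f (a' i) = a i" if "i \<in> Field r" for i
    using a[OF that] im by (auto simp: a'_def inv_into_into f_inv_into_f)
  have diff_a: "val G (a' i \<otimes>\<^bsub>G\<^esub> inv\<^bsub>G\<^esub> (a' j)) = val G' (a i \<otimes>\<^bsub>G'\<^esub> inv\<^bsub>G'\<^esub> (a j))"
    if "(i, j) \<in> r - Id" for i j
  proof -
    have "i \<in> Field r" "j \<in> Field r" using that by (auto simp: Field_def)
    then show ?thesis using diff[of "a' i" "a' j"] a'[of i] a'[of j] by simp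
  qed
  have "pseudo_cauchy G r a'"
    using pc a' unfolding pseudo_cauchy_def by (simp add: diff_a del: Diff_iff)
  \<comment> \<open>The indices have the type of the copy, not that of \<open>G\<close>, so the
    version for arbitrary index types is required.\<close>
  then obtain x where x: "pseudo_limit G r a' x" using pseudo_complete_any_index[OF G complete] by blast
  then have xG: "x \<in> carrier G" by (simp add: pseudo_limit_def)
  have "pseudo_limit G' r a (f x)"
  proof -
    obtain \<beta> where \<beta>: "\<beta> \<in> Field r" and eq: "\<And>i j. \<lbrakk>(\<beta>, i) \<in> r - Id; (i, j) \<in> r - Id\<rbrakk>
        \<Longrightarrow> val G (a' i \<otimes>\<^bsub>G\<^esub> inv\<^bsub>G\<^esub> x) = val G (a' i \<otimes>\<^bsub>G\<^esub> inv\<^bsub>G\<^esub> (a' j))"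
      using x unfolding pseudo_limit_def by blast
    show ?thesis
      unfolding pseudo_limit_def
    proof (intro conjI bexI[of _ \<beta>] allI impI \<beta>)
      show "f x \<in> carrier G'" using xG by simp
      fix i j assume "(\<beta>, i) \<in> r - Id \<and> (i, j) \<in> r - Id"
      then have bi: "(\<beta>, i) \<in> r - Id" and ij: "(i, j) \<in> r - Id" by blast+
      then have "i \<in> Field r" by (auto simp: Field_def)
      then show "val G' (a i \<otimes>\<^bsub>G'\<^esub> inv\<^bsub>G'\<^esub> (f x)) = val G' (a i \<otimes>\<^bsub>G'\<^esub> inv\<^bsub>G'\<^esub> (a j))"
        using eq[OF bi ij] diff_a[OF ij] diff[of "a' i" x] a'[of i] xG by simp
    qed
  qed
  then show "\<exists>x. pseudo_limit G' r a x" by blast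
qed

lemma pseudo_complete_imp_maximal:
  assumes G: "valued_group G" and complete: "pseudo_complete G"
  shows "maximal G"
  unfolding maximal_def
proof (intro notI, elim exE conjE)
  fix G' :: "('a \<times> int, 'b) vgroup" and H f
  assume f: "f \<in> val_iso G G'" and im: "immediate_extension G' H" and sub: "carrier G' \<subset> carrier H"
  have ext: "extension G' H" using im by (simp add: immediate_extension_def)
  then have "pseudo_complete G'"
    using pseudo_complete_val_iso[OF G _ f complete] by (simp add: extension_def)
  then have "maximal_in G' H"
    by (intro pseudo_complete_in_imp_maximal_in[OF ext])
      (simp add: pseudo_complete_def pseudo_complete_in_def)
  \<comment> \<open>The immediate extension \<open>H\<close> of G' serves as its own ambient
    group.\<close>
  moreover have "extension H H" using ext by (simp add: extension_def)
  ultimately show False using im sub by (auto simp: maximal_in_def)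
qed

subsection \<open>Maximality implies pseudo-completeness\<close>

text \<open>
  The group \<open>K\<close> below adjoins a formal pseudo-limit \<open>b\<close> with \<open>m b = g\<close> to \<open>G\<close>, where \<open>m \<int>\<close> is the group of all \<open>k\<close> such that
  the multiples \<open>k a\<^sub>i\<close> have a limit. The pair \<open>(h, k)\<close> stands for \<open>h + k b\<close>, and \<open>reduce\<close> brings \<open>k\<close> to its
  remainder modulo \<open>m\<close>. For \<open>m = 0\<close> the conventions \<open>k div 0 = 0\<close> and \<open>k mod 0 = k\<close> yield \<open>G \<oplus> \<int> b\<close>.
\<close>
locale formal_limit = pseudo_cauchy_net G F a c
  for G :: "('a, 'v::{linorder,order_top}) vgroup" (structure)
    and F :: "'i filter" and a c +
  fixes m :: int and g :: 'a
  assumes m_limit: "multiple_limit m g"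
    and m_dvd: "multiple_limit k h \<Longrightarrow> m dvd k"
begin

lemma g_closed [simp]: "g \<in> carrier G"
  using m_limit by (simp add: multiple_limit_def)

definition reduce :: "'a \<times> int \<Rightarrow> 'a \<times> int" where
  "reduce x = (fst x \<otimes> g [^] (snd x div m), snd x mod m)"

text \<open>Normal forms for the quotient of G \<oplus> \<int> b by the subgroup generated by m b -
  g.\<close>

definition R :: "('a \<times> int) set" where
  "R = {x. fst x \<in> carrier G \<and> snd x mod m = snd x}"

text \<open>Substitutes a_i for the formal element b.\<close>

definition approx :: "'i \<Rightarrow> 'a \<times> int \<Rightarrow> 'a" where
  "approx i x = fst x \<otimes> a i [^] snd x"

text \<open>The value is the eventual value of the approximations: it exists on \<open>R\<close> by
  \<open>val_K_ev\<close> and is unique because the filter is nontrivial.\<close>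

definition K :: "('a \<times> int, 'v) vgroup" where
  "K = \<lparr>carrier = R, mult = \<lambda>x y. reduce (fst x \<otimes> fst y, snd x + snd y), one = (\<one>, 0),
     val = \<lambda>x. THE w. \<forall>\<^sub>F i in F. val G (approx i x) = w\<rparr>"

lemma K_sel:
  "carrier K = R" "x \<otimes>\<^bsub>K\<^esub> y = reduce (fst x \<otimes> fst y, snd x + snd y)" "\<one>\<^bsub>K\<^esub> = (\<one>, 0)"
  by (simp_all add: K_def)

lemma reduce_closed: "fst x \<in> carrier G \<Longrightarrow> reduce x \<in> R"
  by (simp add: reduce_def R_def)

lemma reduce_id: "x \<in> R \<Longrightarrow> reduce x = x"
proof -
  assume x: "x \<in> R"
  have "m * (snd x div m) = 0" using x mult_div_mod_eq[of m "snd x"] by (simp add: R_def)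
  \<comment> \<open>Either m = 0 and the quotient is 0 by convention, or the factor m
    cancels.\<close>
  then have "snd x div m = 0" by auto
  then show ?thesis using x by (simp add: reduce_def R_def prod_eq_iff)
qed

text \<open>The quotient removed first and the one removed later add up to the quotient of the sum,
  so the same multiple of g is carried. Associativity in \<open>K\<close> rests on this.\<close>

lemma reduce_absorb:
  assumes "fst x \<in> carrier G" "fst y \<in> carrier G"
  shows "reduce (fst (reduce x) \<otimes> fst y, snd (reduce x) + snd y) = reduce (fst x \<otimes> fst y, snd x + snd y)"
proof -
  have "snd x div m + (snd x mod m + snd y) div m = (snd x + snd y) div m"
  proof (cases "m = 0")
    case False
    have "(snd x + snd y) div m = ((snd x mod m + snd y) + m * (snd x div m)) div m"
      by (simp add: algebra_simps)
    also have "\<dots> = snd x div m + (snd x mod m + snd y) div m"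
      using False by (subst div_mult_self2) simp_all
    finally show ?thesis by simp
  qed simp
  then have "g [^] (snd x div m) \<otimes> g [^] ((snd x mod m + snd y) div m) = g [^] ((snd x + snd y) div m)"
    by (simp flip: int_pow_mult)
  moreover have "fst x \<otimes> p \<otimes> fst y \<otimes> q = fst x \<otimes> fst y \<otimes> (p \<otimes> q)"
    if "p \<in> carrier G" "q \<in> carrier G" for p q
    using that assms by (simp add: m_ac)
  ultimately show ?thesis using assms by (simp add: reduce_def mod_add_left_eq)
qed

lemma group_K: "comm_group K"
proof (rule comm_groupI; unfold K_sel)
  have fst_reduce: "fst (reduce x) \<in> carrier G" if "fst x \<in> carrier G" for x
    using reduce_closed[OF that] by (simp add: R_def)
  have fstR: "fst x \<in> carrier G" if "x \<in> R" for x using that by (simp add: R_def)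
  show "(\<one>, 0) \<in> R" by (simp add: R_def)
  fix x y assume x: "x \<in> R" and y: "y \<in> R"
  show "reduce (fst x \<otimes> fst y, snd x + snd y) \<in> R" using x y by (intro reduce_closed) (simp add: R_def)
  show "reduce (fst x \<otimes> fst y, snd x + snd y) = reduce (fst y \<otimes> fst x, snd y + snd x)"
    using x y by (simp add: R_def m_comm add.commute)
  show "reduce (fst (\<one>, 0) \<otimes> fst x, snd (\<one>, 0) + snd x) = x"
    using reduce_id[OF x] fstR[OF x] by simp
  show "\<exists>y\<in>R. reduce (fst y \<otimes> fst x, snd y + snd x) = (\<one>, 0)"
  proof
    show "reduce (inv (fst x), - snd x) \<in> R" using fstR[OF x] by (intro reduce_closed) simp
    show "reduce (fst (reduce (inv (fst x), - snd x)) \<otimes> fst x, snd (reduce (inv (fst x), - snd x)) + snd x) = (\<one>, 0)"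
      using reduce_absorb[of "(inv (fst x), - snd x)" x] fstR[OF x] by (simp add: reduce_def)
  qed
  fix z assume z: "z \<in> R"
  have "reduce (fst (reduce (fst x \<otimes> fst y, snd x + snd y)) \<otimes> fst z,
      snd (reduce (fst x \<otimes> fst y, snd x + snd y)) + snd z)
    = reduce (fst x \<otimes> fst y \<otimes> fst z, snd x + snd y + snd z)"
    using reduce_absorb[of "(fst x \<otimes> fst y, snd x + snd y)" z] fstR x y z by simp
  \<comment> \<open>\<open>reduce_absorb\<close> treats only the left summand, so the sum is rotated
    before the inner reduction is reinserted.\<close>
  also have "\<dots> = reduce (fst y \<otimes> fst z \<otimes> fst x, snd y + snd z + snd x)"
    using fstR x y z by (simp add: m_ac add_ac)
  also have "\<dots> = reduce (fst (reduce (fst y \<otimes> fst z, snd y + snd z)) \<otimes> fst x,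
      snd (reduce (fst y \<otimes> fst z, snd y + snd z)) + snd x)"
    using reduce_absorb[of "(fst y \<otimes> fst z, snd y + snd z)" x] fstR x y z by simp
  also have "\<dots> = reduce (fst x \<otimes> fst (reduce (fst y \<otimes> fst z, snd y + snd z)),
      snd x + snd (reduce (fst y \<otimes> fst z, snd y + snd z)))"
    using fstR x y z fst_reduce by (simp add: m_comm add.commute)
  finally show "reduce (fst (reduce (fst x \<otimes> fst y, snd x + snd y)) \<otimes> fst z,
      snd (reduce (fst x \<otimes> fst y, snd x + snd y)) + snd z)
    = reduce (fst x \<otimes> fst (reduce (fst y \<otimes> fst z, snd y + snd z)),
      snd x + snd (reduce (fst y \<otimes> fst z, snd y + snd z)))" .
qed

lemma diff_K:
  assumes x: "x \<in> R" and y: "y \<in> R"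
  shows "x \<otimes>\<^bsub>K\<^esub> inv\<^bsub>K\<^esub> y = reduce (fst x \<otimes> inv (fst y), snd x - snd y)"
proof -
  interpret K: comm_group K by (rule group_K)
  have fst: "fst x \<in> carrier G" "fst y \<in> carrier G" using x y by (simp_all add: R_def)
  have "reduce (inv (fst y), - snd y) \<otimes>\<^bsub>K\<^esub> y = \<one>\<^bsub>K\<^esub>"
    using reduce_absorb[of "(inv (fst y), - snd y)" y] fst by (simp add: K_sel) (simp add: reduce_def)
  then have "inv\<^bsub>K\<^esub> y = reduce (inv (fst y), - snd y)"
    using y fst by (intro K.inv_equality) (simp_all add: K_sel reduce_closed)
  moreover have "x \<otimes>\<^bsub>K\<^esub> inv\<^bsub>K\<^esub> y = inv\<^bsub>K\<^esub> y \<otimes>\<^bsub>K\<^esub> x"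
    using x y by (intro K.m_comm) (simp_all add: K_sel flip: K_sel(1))
  ultimately show ?thesis
    using reduce_absorb[of "(inv (fst y), - snd y)" x] fst by (simp add: K_sel(2) m_comm)
qed

section \<open>The valuation of the formal extension\<close>

lemma val_K_eq:
  assumes "\<forall>\<^sub>F i in F. val G (approx i x) = w"
  shows "val K x = w"
proof -
  have "(THE u. \<forall>\<^sub>F i in F. val G (approx i x) = u) = w"
  proof (rule the_equality)
    show "\<forall>\<^sub>F i in F. val G (approx i x) = w" by (rule assms)
    show "u = w" if "\<forall>\<^sub>F i in F. val G (approx i x) = u" for u
      using eventually_happens'[OF nontrivial eventually_conj[OF assms that]] by auto
  qed
  then show ?thesis by (simp add: K_def)
qed

text \<open>A nonzero remainder k is not divisible by m, so k a_i has no limit and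
  \<open>eventually_const\<close> applies. For k = 0 the approximations are constant.\<close>

lemma val_K_ev:
  assumes x: "x \<in> R"
  shows "\<forall>\<^sub>F i in F. val G (approx i x) = val K x \<and> (snd x \<noteq> 0 \<longrightarrow> val K x < c i)"
proof -
  have "\<exists>w. \<forall>\<^sub>F i in F. val G (approx i x) = w \<and> (snd x \<noteq> 0 \<longrightarrow> w < c i)"
  proof (cases "snd x = 0")
    case True
    then show ?thesis using x by (intro exI[of _ "val G (fst x)"]) (simp add: approx_def R_def)
  next
    case False
    then have "\<not> m dvd snd x" using x by (simp add: R_def dvd_eq_mod_eq_0)
    then have "\<not> multiple_limit (snd x) h" for h using m_dvd by blast
    then show ?thesis
      using eventually_const[of "snd x" "fst x"] x False by (simp add: approx_def R_def)
  qed
  then obtain w where w: "\<forall>\<^sub>F i in F. val G (approx i x) = w \<and> (snd x \<noteq> 0 \<longrightarrow> w < c i)" ..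
  then have "val K x = w" by (intro val_K_eq eventually_mono[OF w]) simp
  then show ?thesis using w by simp
qed

lemma val_K_G: "h \<in> carrier G \<Longrightarrow> val K (h, 0) = val G h"
  by (rule val_K_eq) (simp add: approx_def)

text \<open>Replacing m b by g changes the approximation by a multiple of g - m a_i, which has value
  at least \<open>c i\<close> for late i.\<close>

lemma approx_reduce:
  assumes x: "fst x \<in> carrier G"
  shows "\<forall>\<^sub>F i in F. c i \<le> val G (approx i (reduce x) \<otimes> inv (approx i x))"
proof -
  have "\<forall>\<^sub>F i in F. c i \<le> val G (a i [^] m \<otimes> inv g)" using m_limit by (simp add: multiple_limit_def)
  from this ev_carrier show ?thesis
  proof eventually_elim
    case (elim i)
    let ?q = "snd x div m"
    have "a i [^] snd x = a i [^] (m * ?q + snd x mod m)" by simp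
    also have "\<dots> = (a i [^] m) [^] ?q \<otimes> a i [^] (snd x mod m)"
      using elim(2) by (simp only: int_pow_mult int_pow_pow)
    finally have eq: "approx i x = fst x \<otimes> ((a i [^] m) [^] ?q \<otimes> a i [^] (snd x mod m))"
      by (simp add: approx_def)
    have shuffle: "(p \<otimes> q \<otimes> r) \<otimes> inv (p \<otimes> (s \<otimes> r)) = q \<otimes> inv s"
      if "p \<in> carrier G" "q \<in> carrier G" "r \<in> carrier G" "s \<in> carrier G" for p q r s
    proof -
      have "p \<otimes> q \<otimes> r = (p \<otimes> r) \<otimes> q" "p \<otimes> (s \<otimes> r) = (p \<otimes> r) \<otimes> s" using that by (simp_all add: m_ac)
      then show ?thesis using mult_diff_mult[of "p \<otimes> r" q "p \<otimes> r" s] that by simp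
    qed
    have "approx i (reduce x) \<otimes> inv (approx i x) = g [^] ?q \<otimes> inv ((a i [^] m) [^] ?q)"
      unfolding eq using x elim(2) by (simp add: approx_def reduce_def shuffle del: int_pow_pow)
    also have "\<dots> = (g \<otimes> inv (a i [^] m)) [^] ?q" using elim(2) by (simp add: int_pow_diff_distrib)
    finally show ?case
      using val_int_pow_ge[of "g \<otimes> inv (a i [^] m)" ?q] elim val_minus_commute[of g "a i [^] m"] by auto
  qed
qed

text \<open>Approximations are additive up to the error of \<open>approx_reduce\<close>. If x or y
  has a nonzero second component, its value lies below \<open>c i\<close>, so the error cannot spoil
  the ultrametric inequality; otherwise the inequality is that of \<open>G\<close>.\<close>

lemma valued_group_K: "valued_group K"
proof -
  interpret K: comm_group K by (rule group_K)
  show ?thesis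
  proof unfold_locales
    fix x assume "x \<in> carrier K"
    then have x: "x \<in> R" by (simp add: K_sel)
    show "val K x = top_class.top \<longleftrightarrow> x = \<one>\<^bsub>K\<^esub>"
    proof (cases "snd x = 0")
      case True
      then have "x = (fst x, 0)" by (simp add: prod_eq_iff)
      then show ?thesis using val_K_G[of "fst x"] x val_eq_top[of "fst x"] by (auto simp: R_def K_sel)
    next
      case False
      \<comment> \<open>A value below some \<open>c i\<close> cannot be \<infinity>.\<close>
      obtain i where "val K x < c i"
        using eventually_happens'[OF nontrivial val_K_ev[OF x]] False by blast
      then have "val K x \<noteq> top_class.top" using top_greatest[of "c i"] by auto
      then show ?thesis using False by (auto simp: K_sel)
    qed
  next
    fix x y assume "x \<in> carrier K" "y \<in> carrier K"
    then have x: "x \<in> R" and y: "y \<in> R" by (simp_all add: K_sel)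
    have fst: "fst x \<in> carrier G" "fst y \<in> carrier G" using x y by (simp_all add: R_def)
    let ?z = "(fst x \<otimes> inv (fst y), snd x - snd y)"
    have z: "reduce ?z \<in> R" using fst by (intro reduce_closed) simp
    have "min (val K x) (val K y) \<le> val K (reduce ?z)"
    proof (cases "snd x = 0 \<and> snd y = 0")
      case True
      then have "x = (fst x, 0)" "y = (fst y, 0)" by (simp_all add: prod_eq_iff)
      moreover have "reduce ?z = (fst x \<otimes> inv (fst y), 0)" using True fst by (simp add: reduce_def)
      ultimately show ?thesis using val_K_G fst val_diff[of "fst x" "fst y"] by (metis inv_closed m_closed)
    next
      case False
      have "fst ?z \<in> carrier G" using fst by simp
      note red = approx_reduce[OF this]
      obtain i where i: "a i \<in> carrier G" "c i \<le> val G (approx i (reduce ?z) \<otimes> inv (approx i ?z))"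
        "val G (approx i x) = val K x" "val G (approx i y) = val K y"
        "val G (approx i (reduce ?z)) = val K (reduce ?z)"
        "snd x \<noteq> 0 \<longrightarrow> val K x < c i" "snd y \<noteq> 0 \<longrightarrow> val K y < c i"
        using eventually_happens'[OF nontrivial eventually_conj[OF ev_carrier eventually_conj[OF red
          eventually_conj[OF val_K_ev[OF x] eventually_conj[OF val_K_ev[OF y] val_K_ev[OF z]]]]]] by blast
      have cl: "approx i x \<in> carrier G" "approx i y \<in> carrier G" "approx i ?z \<in> carrier G"
          "approx i (reduce ?z) \<in> carrier G"
        using fst i(1) z by (simp_all add: approx_def R_def)
      have "approx i ?z = approx i x \<otimes> inv (approx i y)"
        using fst i(1) by (simp add: approx_def int_pow_diff mult_diff_mult)
      then have 1: "min (val K x) (val K y) \<le> val G (approx i ?z)"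
        using val_diff[OF cl(1,2)] i(3,4) by simp
      have "min (val K x) (val K y) \<le> c i" using False i(6,7) by (auto simp: min_le_iff_disj)
      then have 2: "min (val K x) (val K y) \<le> val G (approx i (reduce ?z) \<otimes> inv (approx i ?z))"
        using i(2) by (rule order_trans)
      have "approx i ?z \<otimes> (approx i (reduce ?z) \<otimes> inv (approx i ?z)) = approx i (reduce ?z)"
        using mult_diff_cancel[of "approx i ?z" \<one> "approx i (reduce ?z)"] cl by simp
      then have 3: "min (val G (approx i ?z)) (val G (approx i (reduce ?z) \<otimes> inv (approx i ?z)))
          \<le> val G (approx i (reduce ?z))"
        using val_mult[of "approx i ?z" "approx i (reduce ?z) \<otimes> inv (approx i ?z)"] cl by simp
      show ?thesis using order_trans[OF min.boundedI[OF 1 2] 3] by (simp only: i(5))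
    qed
    then show "min (val K x) (val K y) \<le> val K (x \<otimes>\<^bsub>K\<^esub> inv\<^bsub>K\<^esub> y)" by (simp only: diff_K[OF x y])
  qed
qed

section \<open>The copy of G in the formal extension\<close>

definition G0 :: "('a \<times> int, 'v) vgroup" where
  "G0 = K\<lparr>carrier := carrier G \<times> {0}\<rparr>"

lemma extension_G0: "extension G0 K"
proof -
  interpret K: valued_group K by (rule valued_group_K)
  have sub: "carrier G \<times> {0} \<subseteq> R" by (auto simp: R_def)
  have "subgroup (carrier G \<times> {0}) K"
  proof (rule K.subgroupI)
    show "carrier G \<times> {0} \<subseteq> carrier K" using sub by (simp add: K_sel)
    show "carrier G \<times> {0} \<noteq> {}" by auto
    fix x assume x: "x \<in> carrier G \<times> {0::int}"
    then have "x \<in> R" using sub by blast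
    then have "inv\<^bsub>K\<^esub> x = reduce (\<one> \<otimes> inv (fst x), 0 - snd x)"
      using diff_K[of "\<one>\<^bsub>K\<^esub>" x] K.one_closed K.l_one[OF K.inv_closed, of x] by (simp add: K_sel(1,3))
    then show "inv\<^bsub>K\<^esub> x \<in> carrier G \<times> {0}" using x by (auto simp: reduce_def)
    fix y assume y: "y \<in> carrier G \<times> {0::int}"
    show "x \<otimes>\<^bsub>K\<^esub> y \<in> carrier G \<times> {0}" using x y by (auto simp: K_sel reduce_def)
  qed
  then show ?thesis unfolding G0_def by (rule K.valued_subgroup)
qed

lemma val_iso_G0: "(\<lambda>h. (h, 0)) \<in> val_iso G G0"
proof -
  have "bij_betw (\<lambda>h. (h, 0::int)) (carrier G) (carrier G \<times> {0})"
    by (auto simp: bij_betw_def inj_on_def)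
  moreover have "(h, 0) \<otimes>\<^bsub>K\<^esub> (h', 0) = (h \<otimes> h', 0)" if "h \<in> carrier G" "h' \<in> carrier G" for h h'
    using that by (simp add: K_sel reduce_def)
  ultimately show ?thesis
    by (auto simp: val_iso_def iso_def hom_def G0_def val_K_G)
qed

text \<open>An element x = h + k b with k \<noteq> 0 is approximated by y = h + k a_i, where val x <
  \<open>c i\<close>. The difference k b - k a_i has approximations k a_j - k a_i, of value at least
  \<open>c i\<close> for late j.\<close>

lemma immediate_G0: "immediate_extension G0 K"
  unfolding immediate_extension_iff[OF extension_G0]
proof (intro ballI impI)
  interpret K: valued_group K by (rule valued_group_K)
  fix x assume "x \<in> carrier K" and x1: "x \<noteq> \<one>\<^bsub>K\<^esub>"
  then have x: "x \<in> R" by (simp add: K_sel)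
  have fst: "fst x \<in> carrier G" using x by (simp add: R_def)
  show "\<exists>y\<in>carrier G0. val K x < val K (x \<otimes>\<^bsub>K\<^esub> inv\<^bsub>K\<^esub> y)"
  proof (cases "snd x = 0")
    case True
    then have "x \<in> carrier G0" using fst by (simp add: G0_def mem_Times_iff)
    moreover have "val K x < val K (x \<otimes>\<^bsub>K\<^esub> inv\<^bsub>K\<^esub> x)"
      using x x1 K.val_eq_top[of x] by (simp add: K_sel(1) K.val_one less_top)
    ultimately show ?thesis by blast
  next
    case False
    let ?k = "snd x"
    obtain i where i: "a i \<in> carrier G" "val K x < c i"
      "\<forall>\<^sub>F j in F. c i < c j \<and> c i \<le> val G (a j [^] ?k \<otimes> inv (a i [^] ?k))"
      using eventually_happens'[OF nontrivial eventually_conj[OF ev_carrier eventually_conj[OF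
        val_K_ev[OF x] ev_increasing_pow[of ?k]]]] False by blast
    define y where "y = (approx i x, 0::int)"
    have app: "approx i x \<in> carrier G" using i(1) fst by (simp add: approx_def)
    have y: "y \<in> carrier G0" "y \<in> R" using app by (simp_all add: y_def G0_def R_def)
    let ?z = "(fst x \<otimes> inv (approx i x), ?k)"
    have z: "?z \<in> R" using x fst app by (simp add: R_def)
    have xy: "x \<otimes>\<^bsub>K\<^esub> inv\<^bsub>K\<^esub> y = ?z"
      using diff_K[OF x y(2)] reduce_id[OF z] by (simp add: y_def)
    from val_K_ev[OF z] i(3) ev_carrier have "\<forall>\<^sub>F j in F. c i \<le> val K ?z"
    proof eventually_elim
      case (elim j)
      have "approx j ?z = a j [^] ?k \<otimes> inv (a i [^] ?k)"
        using mult_diff_mult[of "fst x" \<one> "fst x" "a i [^] ?k"] elim(3) i(1) fst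
        by (simp add: approx_def m_comm)
      then show ?case using elim by simp
    qed
    then have "c i \<le> val K ?z" using eventually_happens'[OF nontrivial] by blast
    then show ?thesis using i(2) y(1) xy by (intro bexI[of _ y]) auto
  qed
qed

lemma not_maximal:
  assumes "\<not> m dvd 1" "m \<ge> 0"
  shows "\<not> maximal G"
proof -
  \<comment> \<open>Here m is 0 or at least 2, so b itself, the pair \<open>(\<one>, 1)\<close>, is
    a normal form outside \<open>G0\<close>.\<close>
  have "1 mod m = 1" using assms by (cases "m = 0") auto
  then have "(\<one>, 1) \<in> carrier K - carrier G0" by (simp add: K_sel(1) R_def G0_def)
  moreover have "carrier G0 \<subseteq> carrier K" using extension_G0 by (simp add: extension_def)
  ultimately have "carrier G0 \<subset> carrier K" by blast
  then show ?thesis using val_iso_G0 immediate_G0 unfolding maximal_def by blast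
qed

end

text \<open>Without a pseudo-limit the multiplier 1 has no limit, so m does not divide 1 and the
  formal extension is proper.\<close>

lemma maximal_imp_pseudo_complete:
  assumes G: "valued_group G" and maximal: "maximal G"
  shows "pseudo_complete G"
  unfolding pseudo_complete_def
proof (intro allI impI, rule ccontr)
  interpret G: valued_group G by fact
  fix r :: "'a rel" and a
  assume pc: "pseudo_cauchy G r a" and no: "\<not> (\<exists>x. pseudo_limit G r a x)"
  obtain c where net: "pseudo_cauchy_net G (tail r) a c"
    and lim: "\<And>x. \<lbrakk>x \<in> carrier G; \<forall>\<^sub>F i in tail r. c i \<le> val G (a i \<otimes>\<^bsub>G\<^esub> inv\<^bsub>G\<^esub> x)\<rbrakk>
      \<Longrightarrow> pseudo_limit G r a x"
    by (rule G.pseudo_cauchy_net_tail[OF pc]) (rule that)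
  interpret pseudo_cauchy_net G "tail r" a c by (rule net)
  obtain m where m: "m \<ge> 0" "\<And>k. (\<exists>g. multiple_limit k g) \<longleftrightarrow> m dvd k"
    using multiple_limits_ideal by blast
  obtain g where "multiple_limit m g" using m(2)[of m] by auto
  then interpret formal_limit G "tail r" a c m g
    by unfold_locales (use m(2) in blast)+
  have "\<not> m dvd 1" using multiple_limit_1 lim no m(2)[of 1] by blast
  then show False using not_maximal m(1) maximal by blast
qed

section \<open>The relative and the absolute equivalence\<close>

theorem theorem1p38:
  fixes G :: "('a, 'v::{linorder,order_top}) vgroup"
  assumes "valued_group G" and "Z_invariant G"
  shows "((\<forall>g\<in>carrier G. \<forall>m::nat. has_maximum (Delta G m g)) \<longrightarrow>
            (\<forall>H. extension G H \<longrightarrow> (maximal_in G H \<longleftrightarrow> pseudo_complete_in G H)))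
       \<and> (maximal G \<longleftrightarrow> pseudo_complete G)"
proof (intro conjI impI allI iffI)
  fix H assume max: "\<forall>g\<in>carrier G. \<forall>m::nat. has_maximum (Delta G m g)" and ext: "extension G H"
  show "pseudo_complete_in G H" if "maximal_in G H"
    using max maximal_in_imp_pseudo_complete_in[OF assms(2) _ ext that] by blast
  show "maximal_in G H" if "pseudo_complete_in G H"
    by (rule pseudo_complete_in_imp_maximal_in[OF ext that])
next
  show "pseudo_complete G" if "maximal G" by (rule maximal_imp_pseudo_complete[OF assms(1) that])
  show "maximal G" if "pseudo_complete G" by (rule pseudo_complete_imp_maximal[OF assms(1) that])
qed

end
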